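(* Let $d\ge 1$. There exists a score estimator $\hat s_t(x)$ (constructed from $n$ i.i.d. samples $x_1,\dots,x_n\sim p_0$) such that the following holds whenever the probability density $p_0$ on $\mathbb{R}^d$ is $\sigma_0$-sub-Gaussian. For any constants $T_1,T_2>0$, let $t_0:=n^{-T_1}$ and $T:=n^{T_2}$. Then for every $t$ with $t_0<t<T$, $$\mathbb{E}\left[\int_{\mathbb{R}^d}\|\hat s_t(x)-s_t(x)\|^2\,p_t(x)\,dx\right]\ \lesssim\ \mathrm{polylog}(n)\,n^{-1}\,t^{-\frac{d+2}{2}}\left(t^{\frac d2}+\sigma_0^d\right),$$ where $s_t(x):=\nabla\log p_t(x)$ is the true score function and $\lesssim$ hides a constant that does not depend on the time $t$ or the sample size $n$.
   Context: Sub-Gaussian: for a real random variable $Y$, $\|Y\|_{\psi_2}=\inf\{C>0:\mathbb{E}[e^{Y^2/C^2}-1]\le 1\}$; for a random vector $X\in\mathbb{R}^d$, $\|X\|_{\psi_2}=\sup_{v\in S^{d-1}}\|\langle X,v\rangle\|_{\psi_2}$. $X$ (or its law/density) is $\sigma$-sub-Gaussian if $\sigma=\|X\|_{\psi_2}<\infty$. $p_0$ is a probability density on $\mathbb{R}^d$; $p_t:=p_0*\phi_t$, where $\phi_t$ is the density of $\mathcal{N}(0,tI_d)$. Thus $p_t$ is the density of $X_0+\sqrt t Z$ with $X_0\sim p_0$ and $Z\sim\mathcal N(0,I_d)$ independent. A score estimator is a rule which, for each sample size $n\ge 2$ and time $t>0$, produces a function $\hat s_t:\mathbb{R}^d\to\mathbb{R}^d$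 from the samples $x_1,\dots,x_n$ (i.i.d. from $p_0$), possibly using auxiliary randomness independent of the samples (such as added Gaussian noise); the rule itself does not depend on the unknown $p_0$. The expectation $\mathbb{E}$ is over the samples and any auxiliary randomness. $\mathrm{polylog}(n):=(\log n)^C$ for some constant $C$. The implicit constants (including this $C$) may depend on $p_0$, $d$, $T_1,T_2$, but not on $t$ and $n$. *)

theory Defs
  imports "HOL-Probability.Probability"
begin

text \<open>
  The space is \<open>real ^ 'd\<close>, of dimension \<open>CARD('d)\<close>. Quantities that may be infinite (Orlicz norms,
  risks) are valued in \<^typ>\<open>ennreal\<close>.
\<close>

definition psi2_norm :: "'w measure \<Rightarrow> ('w \<Rightarrow> real) \<Rightarrow> ennreal" where
  "psi2_norm M Y =
     Inf {ennreal C |C. 0 < C \<and> (\<integral>\<^sup>+ w. ennreal (exp ((Y w)\<^sup>2 / C\<^sup>2) - 1) \<partial>M) \<le> 1}"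

definition psi2_norm_vec :: "'w measure \<Rightarrow> ('w \<Rightarrow> real ^ 'd) \<Rightarrow> ennreal" where
  "psi2_norm_vec M X = (SUP v \<in> sphere 0 1. psi2_norm M (\<lambda>w. X w \<bullet> v))"

definition sub_gaussian :: "'w measure \<Rightarrow> ('w \<Rightarrow> real ^ 'd) \<Rightarrow> real \<Rightarrow> bool" where
  "sub_gaussian M X \<sigma> \<longleftrightarrow> 0 \<le> \<sigma> \<and> psi2_norm_vec M X = ennreal \<sigma>"

definition law :: "(real ^ 'd \<Rightarrow> real) \<Rightarrow> (real ^ 'd) measure" where
  "law p = density lborel (\<lambda>x. ennreal (p x))"

definition probability_density :: "(real ^ 'd \<Rightarrow> real) \<Rightarrow> bool" where
  "probability_density p \<longleftrightarrow>
     p \<in> borel_measurable borel \<and> (\<forall>x. 0 \<le> p x) \<and> prob_space (law p)"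

definition gauss_density :: "real \<Rightarrow> real ^ 'd \<Rightarrow> real" where
  "gauss_density t z = (2 * pi * t) powr (- real CARD('d) / 2) * exp (- (norm z)\<^sup>2 / (2 * t))"

definition smoothed :: "(real ^ 'd \<Rightarrow> real) \<Rightarrow> real \<Rightarrow> real ^ 'd \<Rightarrow> real" where
  "smoothed p t x = (\<integral>y. p y * gauss_density t (x - y) \<partial>lborel)"

definition gradient :: "(real ^ 'd \<Rightarrow> real) \<Rightarrow> real ^ 'd \<Rightarrow> real ^ 'd" where
  "gradient f x = (THE D. GDERIV f x :> D)"

definition score :: "(real ^ 'd \<Rightarrow> real) \<Rightarrow> real \<Rightarrow> real ^ 'd \<Rightarrow> real ^ 'd" where
  "score p t = gradient (\<lambda>x. ln (smoothed p t x))"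

text \<open>
  In \<open>shat n t xs u x\<close> the samples are \<open>xs 0, \<dots>, xs (n - 1)\<close> and \<open>u\<close> is the auxiliary
  randomness: a sequence of reals whose law \<open>W\<close> is part of the rule (a point mass if the rule is
  deterministic). Joint measurability makes the nonnegative integrals in the risk below
  genuine expectations.
\<close>

type_synonym 'd score_rule =
  "nat \<Rightarrow> real \<Rightarrow> (nat \<Rightarrow> real ^ 'd) \<Rightarrow> (nat \<Rightarrow> real) \<Rightarrow> real ^ 'd \<Rightarrow> real ^ 'd"

definition score_estimator :: "(nat \<Rightarrow> real) measure \<Rightarrow> 'd::finite score_rule \<Rightarrow> bool" where
  "score_estimator W shat \<longleftrightarrow>
     prob_space W \<and> sets W = sets (Pi\<^sub>M UNIV (\<lambda>_. borel)) \<and>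
     (\<forall>n\<ge>2. \<forall>t>0.
        (\<lambda>(xs, u, x). shat n t xs u x) \<in>
          borel_measurable (Pi\<^sub>M {..<n} (\<lambda>_. borel) \<Otimes>\<^sub>M W \<Otimes>\<^sub>M borel))"

text \<open>
  The product measure is the joint law of \<open>n\<close> i.i.d. samples from \<open>p\<close> and of the auxiliary
  randomness, independent of the samples.
\<close>

definition score_risk ::
    "(nat \<Rightarrow> real) measure \<Rightarrow> 'd::finite score_rule \<Rightarrow> (real ^ 'd \<Rightarrow> real) \<Rightarrow> nat \<Rightarrow> real \<Rightarrow> ennreal" where
  "score_risk W shat p n t =
     (\<integral>\<^sup>+ (xs, u).
        (\<integral>\<^sup>+ x. ennreal ((norm (shat n t xs u x - score p t x))\<^sup>2 * smoothed p t x) \<partial>lborel)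
      \<partial>(Pi\<^sub>M {..<n} (\<lambda>_. law p) \<Otimes>\<^sub>M W))"

end

theory Submission
  imports Defs
begin

text \<open>
  The estimator is the score of the Gaussian kernel density estimate \<open>p'\<close> of bandwidth \<open>t\<close>, set to \<open>0\<close>
  where \<open>p'\<close> falls below \<open>1 / n\<close> times the peak value \<open>M = (2 \<pi> t) powr (- d / 2)\<close> of the kernel. Both \<open>p'\<close>
  and its gradient are sample means whose variances are at most \<open>M * p / n\<close> and \<open>M * p / (n * t)\<close>, and
  the score of a Gaussian mixture \<open>p\<close> has squared norm at most \<open>2 * ln (M / p) / t\<close>. Hence the expected
  squared error times \<open>p\<close> is at most \<open>M / (n * t)\<close> up to logarithms at every point. This is integrated
  over a ball of radius of order \<open>sqrt ((K + t) * ln n)\<close>, where \<open>K\<close> controls the exponential square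
  moment of the data. Outside of it the error is dominated, for every sample, by an integral against
  the joint law of data and noise, which has sub-Gaussian tails of size \<open>1 / n\<close> there.
\<close>

section \<open>The Gaussian kernel\<close>

text \<open>The tangent line of \<open>exp\<close> at 0, evaluated at \<open>u / 2 - 1\<close>, is
  tight at the maximiser \<open>u = 2\<close> and yields the sharp constant
  \<open>2 / exp 1\<close>.\<close>

lemma mult_exp_neg_half_le_1: "u * exp (- u / 2) \<le> 1" for u :: real
proof -
  have "1 + (u / 2 - 1) \<le> exp (u / 2 - 1)" by (rule exp_ge_add_one_self)
  hence "u \<le> 2 / exp 1 * exp (u / 2)" unfolding exp_diff by (simp add: mult.commute)
  also have "\<dots> \<le> 1 * exp (u / 2)"
    using exp_ge_add_one_self[of 1] by (intro mult_right_mono) (auto simp: field_simps)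
  finally show ?thesis by (simp add: exp_minus field_simps)
qed

lemma gauss_density_eq:
  "gauss_density t z = gauss_density t (0 :: real ^ 'd) * exp (- (norm z)\<^sup>2 / (2 * t))"
  for z :: "real ^ 'd"
  by (simp add: gauss_density_def)

lemma gauss_density_pos [simp]: "0 < t \<Longrightarrow> 0 < gauss_density t z"
  by (simp add: gauss_density_def)

lemma gauss_density_nonneg [simp]: "0 \<le> gauss_density t z"
  by (simp add: gauss_density_def)

lemma gauss_density_le: "0 < t \<Longrightarrow> gauss_density t z \<le> gauss_density t (0 :: real ^ 'd)"
  for z :: "real ^ 'd"
  by (subst gauss_density_eq) (auto intro!: mult_left_le)

lemma borel_measurable_gauss_density [measurable]: "gauss_density t \<in> borel_measurable borel"
  unfolding gauss_density_def[abs_def] by measurable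

lemma norm_sq_gauss_density_le:
  fixes z :: "real ^ 'd"
  assumes "0 < t"
  shows "(norm z)\<^sup>2 * gauss_density t z \<le> t * gauss_density t (0 :: real ^ 'd)"
proof -
  have "(norm z)\<^sup>2 * gauss_density t z
      = t * gauss_density t (0 :: real ^ 'd) * ((norm z)\<^sup>2 / t * exp (- ((norm z)\<^sup>2 / t) / 2))"
    using assms by (subst gauss_density_eq) (simp add: field_simps)
  also have "\<dots> \<le> t * gauss_density t (0 :: real ^ 'd) * 1"
    using assms by (intro mult_left_mono mult_exp_neg_half_le_1) auto
  finally show ?thesis by simp
qed

definition gauss_grad :: "real \<Rightarrow> real ^ 'd \<Rightarrow> real ^ 'd" where
  "gauss_grad t z = (- gauss_density t z / t) *\<^sub>R z"

lemma borel_measurable_gauss_grad [measurable]: "gauss_grad t \<in> borel_measurable borel"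
  unfolding gauss_grad_def[abs_def] by measurable

text \<open>One factor of the density is kept on the right, so that integration against a mixing
  measure gives a multiple of the mixture itself. The variance of the gradient estimate inherits
  this proportionality.\<close>

lemma norm_gauss_grad_sq_le:
  fixes z :: "real ^ 'd"
  assumes "0 < t"
  shows "(norm (gauss_grad t z))\<^sup>2 \<le> gauss_density t (0 :: real ^ 'd) / t * gauss_density t z"
proof -
  have "(norm (gauss_grad t z))\<^sup>2 = ((norm z)\<^sup>2 * gauss_density t z) * gauss_density t z / t\<^sup>2"
    using assms by (simp add: gauss_grad_def power_mult_distrib power_divide power2_eq_square)
  also have "\<dots> \<le> (t * gauss_density t (0 :: real ^ 'd)) * gauss_density t z / t\<^sup>2"
    using assms by (intro divide_right_mono mult_right_mono norm_sq_gauss_density_le) auto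
  finally show ?thesis using assms by (simp add: power2_eq_square)
qed

lemma norm_gauss_grad_le:
  fixes z :: "real ^ 'd"
  assumes "0 < t"
  shows "norm (gauss_grad t z) \<le> gauss_density t (0 :: real ^ 'd) / sqrt t"
proof (rule power2_le_imp_le)
  have "(norm (gauss_grad t z))\<^sup>2 \<le> gauss_density t (0 :: real ^ 'd) / t * gauss_density t z"
    by (rule norm_gauss_grad_sq_le[OF assms])
  also have "\<dots> \<le> gauss_density t (0 :: real ^ 'd) / t * gauss_density t (0 :: real ^ 'd)"
    using assms by (intro mult_left_mono gauss_density_le) auto
  finally show "(norm (gauss_grad t z))\<^sup>2 \<le> (gauss_density t (0 :: real ^ 'd) / sqrt t)\<^sup>2"
    using assms by (simp add: power_divide power2_eq_square)
qed (use assms in auto)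

text \<open>Second-order Taylor expansion along the segment from \<open>z\<close> to
  \<open>z + h\<close>. The remainder is uniform in \<open>z\<close>, so it can later be integrated
  over the mixing measure.\<close>

lemma gauss_density_taylor:
  fixes z h :: "real ^ 'd"
  assumes t: "0 < t"
  shows "\<bar>gauss_density t (z + h) - gauss_density t z - h \<bullet> gauss_grad t z\<bar>
           \<le> gauss_density t (0 :: real ^ 'd) / t * (norm h)\<^sup>2"
proof -
  define M where "M = gauss_density t (0 :: real ^ 'd)"
  define q where "q s = (norm z)\<^sup>2 + 2 * s * (z \<bullet> h) + s\<^sup>2 * (norm h)\<^sup>2" for s
  define g where "g s = M * exp (- q s / (2 * t))" for s
  \<comment> \<open>\<open>- l\<close> is the logarithmic derivative of \<open>g\<close>, the
    density along the segment; \<open>D\<close> lists \<open>g\<close> and its first two derivatives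
    in the form that \<open>Maclaurin\<close> expects.\<close>
  define l where "l s = (z \<bullet> h + s * (norm h)\<^sup>2) / t" for s
  define D where "D m = (case m of 0 \<Rightarrow> g | Suc 0 \<Rightarrow> (\<lambda>s. - l s * g s)
      | _ \<Rightarrow> (\<lambda>s. ((l s)\<^sup>2 - (norm h)\<^sup>2 / t) * g s))" for m :: nat
  have q: "(norm (z + s *\<^sub>R h))\<^sup>2 = q s" for s
    unfolding q_def power2_norm_eq_inner
    by (simp add: inner_add_left inner_add_right inner_commute power2_eq_square algebra_simps)
  have g: "gauss_density t (z + s *\<^sub>R h) = g s" for s
    by (subst gauss_density_eq) (simp add: q g_def M_def)
  have dg: "(g has_real_derivative - l s * g s) (at s)" for s
    unfolding g_def[abs_def] q_def l_def using t
    by (auto intro!: derivative_eq_intros simp: field_simps power2_eq_square)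
  have dl: "(l has_real_derivative (norm h)\<^sup>2 / t) (at s)" for s
    unfolding l_def[abs_def] using t by (auto intro!: derivative_eq_intros)
  have dlg: "((\<lambda>s. - l s * g s) has_real_derivative ((l s)\<^sup>2 - (norm h)\<^sup>2 / t) * g s) (at s)" for s
    by (rule DERIV_cong[OF DERIV_mult[OF DERIV_minus[OF dl] dg]])
       (simp add: algebra_simps power2_eq_square)
  have D: "\<forall>m s. m < 2 \<and> 0 \<le> s \<and> s \<le> 1 \<longrightarrow> (D m has_real_derivative D (Suc m) s) (at s)"
  proof (intro allI impI)
    fix m :: nat and s :: real assume "m < 2 \<and> 0 \<le> s \<and> s \<le> 1"
    hence "m = 0 \<or> m = Suc 0" by auto
    thus "(D m has_real_derivative D (Suc m) s) (at s)"
      using dg dlg by (auto simp: D_def)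
  qed
  have "\<exists>s. 0 < s \<and> s < 1 \<and> g 1 = (\<Sum>m<2. (D m 0 / fact m) * 1 ^ m) + (D 2 s / fact 2) * 1 ^ 2"
    by (rule Maclaurin) (use D in \<open>auto simp: D_def\<close>)
  then obtain s where s: "g 1 = (\<Sum>m<2. (D m 0 / fact m) * 1 ^ m) + (D 2 s / fact 2) * 1 ^ 2"
    by blast
  have D0: "D 0 0 = gauss_density t z" using g[of 0] by (simp add: D_def)
  have D1: "D (Suc 0) 0 = h \<bullet> gauss_grad t z"
    using g[of 0] by (simp add: D_def l_def gauss_grad_def inner_commute)
  have "gauss_density t (z + h) - gauss_density t z - h \<bullet> gauss_grad t z = D 2 s / 2"
    using s g[of 1] D0 D1 by (simp add: numeral_2_eq_2)
  \<comment> \<open>A difference of two nonnegative terms, each at most \<open>M / t\<close> times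
    the squared norm of \<open>h\<close>: the first by Cauchy-Schwarz and
    \<open>norm_sq_gauss_density_le\<close>, the second by the peak value.\<close>
  moreover have "\<bar>D 2 s\<bar> \<le> 2 * (M / t * (norm h)\<^sup>2)"
  proof -
    have "l s = (z + s *\<^sub>R h) \<bullet> h / t"
      by (simp add: l_def inner_add_left power2_norm_eq_inner)
    hence "\<bar>l s\<bar> \<le> norm (z + s *\<^sub>R h) * norm h / t"
      using t Cauchy_Schwarz_ineq2[of "z + s *\<^sub>R h" h] by (simp add: divide_right_mono)
    hence "\<bar>l s\<bar>\<^sup>2 \<le> (norm (z + s *\<^sub>R h) * norm h / t)\<^sup>2" by (intro power_mono) auto
    hence "(l s)\<^sup>2 * g s \<le> (norm (z + s *\<^sub>R h) * norm h / t)\<^sup>2 * g s"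
      by (intro mult_right_mono) (auto simp flip: g)
    also have "\<dots> = ((norm (z + s *\<^sub>R h))\<^sup>2 * gauss_density t (z + s *\<^sub>R h)) * ((norm h)\<^sup>2 / t\<^sup>2)"
      by (simp add: g power_mult_distrib power_divide)
    also have "\<dots> \<le> (t * M) * ((norm h)\<^sup>2 / t\<^sup>2)"
      unfolding M_def by (intro mult_right_mono norm_sq_gauss_density_le t) auto
    finally have 1: "(l s)\<^sup>2 * g s \<le> M / t * (norm h)\<^sup>2" using t by (simp add: power2_eq_square)
    have "(norm h)\<^sup>2 / t * g s \<le> (norm h)\<^sup>2 / t * M"
      unfolding M_def g[symmetric] by (intro mult_left_mono gauss_density_le) (use t in auto)
    moreover have "0 \<le> (l s)\<^sup>2 * g s" "0 \<le> (norm h)\<^sup>2 / t * g s"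
      using t by (auto simp flip: g)
    moreover have "D 2 s = (l s)\<^sup>2 * g s - (norm h)\<^sup>2 / t * g s"
      by (simp add: D_def numeral_2_eq_2 algebra_simps)
    ultimately show ?thesis using 1 by (simp add: mult.commute)
  qed
  ultimately show ?thesis by (simp add: M_def)
qed

section \<open>Gaussian mixtures and their scores\<close>

text \<open>The mixing measure is arbitrary, so that the same facts serve the true density
  (\<open>law p\<close>) and the kernel density estimate (the empirical measure).\<close>

definition mollify :: "(real ^ 'd) measure \<Rightarrow> real \<Rightarrow> real ^ 'd \<Rightarrow> real" where
  "mollify N t x = (\<integral>y. gauss_density t (x - y) \<partial>N)"

definition mollify_grad :: "(real ^ 'd) measure \<Rightarrow> real \<Rightarrow> real ^ 'd \<Rightarrow> real ^ 'd" where
  "mollify_grad N t x = (\<integral>y. gauss_grad t (x - y) \<partial>N)"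

locale borel_prob = prob_space N for N :: "(real ^ 'd) measure" +
  assumes sets_N [measurable_cong, simp]: "sets N = sets borel"
begin

lemma integrable_gauss_density [simp]: "0 < t \<Longrightarrow> integrable N (\<lambda>y. gauss_density t (x - y))"
  by (intro integrable_const_bound[where B = "gauss_density t (0 :: real ^ 'd)"])
     (auto simp: gauss_density_le)

lemma integrable_gauss_grad [simp]: "0 < t \<Longrightarrow> integrable N (\<lambda>y. gauss_grad t (x - y))"
  by (intro integrable_const_bound[where B = "gauss_density t (0 :: real ^ 'd) / sqrt t"])
     (auto simp: norm_gauss_grad_le)

lemma integrable_norm_sq_gauss_density [simp]:
  "0 < t \<Longrightarrow> integrable N (\<lambda>y. (norm (x - y))\<^sup>2 * gauss_density t (x - y))"
  by (intro integrable_const_bound[where B = "t * gauss_density t (0 :: real ^ 'd)"])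
     (auto simp: norm_sq_gauss_density_le)

lemma mollify_pos: "0 < t \<Longrightarrow> 0 < mollify N t x"
proof -
  assume t: "0 < t"
  have "0 \<le> mollify N t x" by (simp add: mollify_def)
  moreover have "mollify N t x \<noteq> 0"
  proof
    assume "mollify N t x = 0"
    hence "AE y in N. gauss_density t (x - y) = 0"
      unfolding mollify_def using t by (subst (asm) integral_nonneg_eq_0_iff_AE) auto
    hence "AE y in N. False" using t by (auto simp: less_imp_neq[symmetric])
    thus False by simp
  qed
  ultimately show ?thesis by simp
qed

lemma mollify_le: "0 < t \<Longrightarrow> mollify N t x \<le> gauss_density t (0 :: real ^ 'd)"
  using integral_le_const[of "\<lambda>y. gauss_density t (x - y)" "gauss_density t (0 :: real ^ 'd)"]
  by (simp add: mollify_def gauss_density_le)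

lemma borel_measurable_mollify [measurable]: "mollify N t \<in> borel_measurable borel"
  unfolding mollify_def[abs_def] by measurable

lemma borel_measurable_mollify_grad [measurable]: "mollify_grad N t \<in> borel_measurable borel"
  unfolding mollify_grad_def[abs_def] by measurable

text \<open>Since the Taylor remainder does not depend on the mixing point, it survives integration
  against a probability measure; this replaces differentiation under the integral by dominated
  convergence.\<close>

lemma GDERIV_mollify:
  assumes t: "0 < t"
  shows "GDERIV (mollify N t) x :> mollify_grad N t x"
  unfolding gderiv_def
proof (rule has_derivativeI_sandwich[where e = 1])
  show "bounded_linear (\<lambda>h. h \<bullet> mollify_grad N t x)" by (rule bounded_linear_inner_left)
  let ?M = "gauss_density t (0 :: real ^ 'd)"
  show "norm (mollify N t y - mollify N t x - (y - x) \<bullet> mollify_grad N t x) / norm (y - x)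
      \<le> ?M / t * norm (y - x)" if "y \<noteq> x" for y
  proof -
    define h where "h = y - x"
    have y: "y - w = (x - w) + h" for w by (simp add: h_def)
    have "mollify N t y - mollify N t x - h \<bullet> mollify_grad N t x
        = (\<integral>w. gauss_density t (y - w) - gauss_density t (x - w) - h \<bullet> gauss_grad t (x - w) \<partial>N)"
      using t by (simp add: mollify_def mollify_grad_def)
    also have "norm \<dots> \<le> (\<integral>w. ?M / t * (norm h)\<^sup>2 \<partial>N)"
      by (rule Bochner_Integration.integral_norm_bound_integral)
         (use t gauss_density_taylor[OF t, of "x - _" h] in \<open>auto simp: y[symmetric]\<close>)
    finally show ?thesis
      using that t by (simp add: h_def prob_space pos_divide_le_eq power2_eq_square mult.assoc)
  qed
  show "((\<lambda>y. ?M / t * norm (y - x)) \<longlongrightarrow> 0) (at x)"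
    using t by (auto intro!: tendsto_eq_intros)
qed auto

end

section \<open>Identification of the true score with a ratio of mixtures\<close>

lemma GDERIV_unique: "GDERIV f x :> a \<Longrightarrow> GDERIV f x :> b \<Longrightarrow> a = b"
  unfolding gderiv_def using has_derivative_unique[of f "\<lambda>h. h \<bullet> a" x "\<lambda>h. h \<bullet> b"]
  by (metis vector_eq_ldot)

lemma gradient_eqI: "GDERIV f x :> D \<Longrightarrow> gradient f x = D"
  unfolding gradient_def by (rule the_equality) (auto intro: GDERIV_unique)

lemma borel_prob_law: "probability_density p \<Longrightarrow> borel_prob (law p)"
  unfolding borel_prob_def borel_prob_axioms_def probability_density_def law_def by simp

lemma smoothed_eq_mollify:
  assumes "probability_density p"
  shows "smoothed p t x = mollify (law p) t x"
  unfolding smoothed_def mollify_def law_def using assms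
  by (subst integral_density) (auto simp: probability_density_def)

lemma score_eq:
  assumes p: "probability_density p" and t: "0 < t"
  shows "score p t x = mollify_grad (law p) t x /\<^sub>R mollify (law p) t x"
proof -
  interpret borel_prob "law p" by (rule borel_prob_law[OF p])
  have "GDERIV (\<lambda>x. ln (mollify (law p) t x)) x :>
      (1 / mollify (law p) t x) *\<^sub>R mollify_grad (law p) t x"
    by (intro GDERIV_DERIV_compose GDERIV_mollify t DERIV_ln_divide mollify_pos)
  thus ?thesis
    unfolding score_def smoothed_eq_mollify[OF p] by (simp add: gradient_eqI divide_inverse)
qed

section \<open>Bounds on the score of a mixture\<close>

context borel_prob
begin

text \<open>Cauchy-Schwarz. After division by the squared mixture: the score is the posterior mean
  of \<open>- (x - y) / t\<close>, so its squared norm is at most the posterior second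
  moment.\<close>

lemma mollify_grad_sq_le:
  assumes t: "0 < t"
  shows "(norm (mollify_grad N t x))\<^sup>2
      \<le> mollify N t x * (\<integral>y. (norm (x - y))\<^sup>2 / t\<^sup>2 * gauss_density t (x - y) \<partial>N)"
proof -
  define W where "W = mollify N t x"
  define a where "a = mollify_grad N t x"
  define S where "S = (\<integral>y. (norm (x - y))\<^sup>2 / t\<^sup>2 * gauss_density t (x - y) \<partial>N)"
  have W: "W > 0" using mollify_pos[OF t] by (simp add: W_def)
  have [simp]: "integrable N (\<lambda>y. (norm (x - y))\<^sup>2 / t\<^sup>2 * gauss_density t (x - y))"
    using integrable_divide[OF integrable_norm_sq_gauss_density[OF t, of x], of "t\<^sup>2"] by simp
  \<comment> \<open>The integrand is the density times the squared norm of \<open>u + a / W\<close>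
    with \<open>u = (x - y) / t\<close>. As \<open>- a / W\<close> is the posterior mean of
    \<open>u\<close>, the integral is \<open>W\<close> times a posterior variance.\<close>
  have "0 \<le> (\<integral>y. (norm (x - y))\<^sup>2 / t\<^sup>2 * gauss_density t (x - y)
      - 2 / W * (a \<bullet> gauss_grad t (x - y)) + (norm a)\<^sup>2 / W\<^sup>2 * gauss_density t (x - y) \<partial>N)"
  proof (rule Bochner_Integration.integral_nonneg)
    fix y
    define u where "u = (1 / t) *\<^sub>R (x - y)"
    have 1: "gauss_grad t (x - y) = - (gauss_density t (x - y) *\<^sub>R u)"
      by (simp add: gauss_grad_def u_def)
    have 2: "(norm (x - y))\<^sup>2 / t\<^sup>2 = (norm u)\<^sup>2"
      using t by (simp add: u_def power_divide)
    have "0 \<le> (norm (u + (1 / W) *\<^sub>R a))\<^sup>2 * gauss_density t (x - y)" by simp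
    also have "(norm (u + (1 / W) *\<^sub>R a))\<^sup>2 = (norm u)\<^sup>2 + 2 / W * (a \<bullet> u) + (norm a)\<^sup>2 / W\<^sup>2"
      unfolding power2_norm_eq_inner
      by (simp add: inner_add_left inner_add_right inner_commute power2_eq_square)
    finally show "0 \<le> (norm (x - y))\<^sup>2 / t\<^sup>2 * gauss_density t (x - y)
      - 2 / W * (a \<bullet> gauss_grad t (x - y)) + (norm a)\<^sup>2 / W\<^sup>2 * gauss_density t (x - y)"
      unfolding 1 2 by (simp add: algebra_simps)
  qed
  also have "\<dots> = S - 2 / W * (a \<bullet> a) + (norm a)\<^sup>2 / W\<^sup>2 * W"
    using t by (simp add: S_def a_def W_def mollify_def mollify_grad_def)
  also have "\<dots> = S - (norm a)\<^sup>2 / W"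
    using W by (simp add: power2_norm_eq_inner) (simp add: power2_eq_square)
  finally have "(norm a)\<^sup>2 \<le> W * S" using W by (simp add: field_simps)
  thus ?thesis by (simp only: W_def a_def S_def)
qed

text \<open>This is Jensen's inequality for \<open>u \<mapsto> u * ln u\<close>, proved through the tangent line at the mean.\<close>

lemma norm_sq_integral_le:
  assumes t: "0 < t"
  shows "(\<integral>y. (norm (x - y))\<^sup>2 * gauss_density t (x - y) \<partial>N)
      \<le> 2 * t * (mollify N t x * ln (gauss_density t (0 :: real ^ 'd) / mollify N t x))"
proof -
  define M where "M = gauss_density t (0 :: real ^ 'd)"
  define W where "W = mollify N t x"
  have W: "W > 0" using mollify_pos[OF t] by (simp add: W_def)
  have M: "M > 0" using t by (simp add: M_def)
  have "(\<integral>y. (norm (x - y))\<^sup>2 * gauss_density t (x - y) \<partial>N)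
      \<le> (\<integral>y. 2 * t * (ln (M / W) * gauss_density t (x - y) + (W - gauss_density t (x - y))) \<partial>N)"
  proof (rule Bochner_Integration.integral_mono)
    fix y
    define f where "f = gauss_density t (x - y)"
    have f: "f > 0" using t by (simp add: f_def)
    \<comment> \<open>The logarithm of the kernel recovers the squared distance, which turns the
      second moment into an entropy-type integral of the kernel values.\<close>
    have "f = M * exp (- (norm (x - y))\<^sup>2 / (2 * t))"
      unfolding f_def M_def by (rule gauss_density_eq)
    hence "ln (M / f) = (norm (x - y))\<^sup>2 / (2 * t)"
      using M by (simp add: ln_div ln_mult)
    hence "(norm (x - y))\<^sup>2 = 2 * t * ln (M / f)" using t by simp
    also have "ln (M / f) = ln (M / W) + ln (W / f)"
      using M W f by (simp add: ln_div)
    finally have "(norm (x - y))\<^sup>2 * f = 2 * t * (ln (M / W) * f + f * ln (W / f))"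
      by (simp add: algebra_simps)
    also have "f * ln (W / f) \<le> f * (W / f - 1)"
      using f W by (intro mult_left_mono ln_le_minus_one) auto
    also have "\<dots> = W - f" using f by (simp add: algebra_simps)
    finally show "(norm (x - y))\<^sup>2 * gauss_density t (x - y)
        \<le> 2 * t * (ln (M / W) * gauss_density t (x - y) + (W - gauss_density t (x - y)))"
      using t by (simp add: f_def)
  qed (use t in auto)
  also have "\<dots> = 2 * t * (ln (M / W) * W)"
    using t by (simp add: prob_space) (simp add: W_def mollify_def)
  finally show ?thesis by (simp add: W_def M_def mult.commute)
qed

text \<open>The two preceding bounds combined, with denominators cleared. It is used twice, for the
  true mixture and for the empirical one, as the last two assumptions of
  \<open>plugin_score_error\<close>.\<close>

lemma mollify_grad_log_bound:
  assumes t: "0 < t"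
  shows "t * (norm (mollify_grad N t x))\<^sup>2
      \<le> 2 * (mollify N t x)\<^sup>2 * ln (gauss_density t (0 :: real ^ 'd) / mollify N t x)"
proof -
  have "t * (norm (mollify_grad N t x))\<^sup>2
      \<le> t * (mollify N t x * ((\<integral>y. (norm (x - y))\<^sup>2 * gauss_density t (x - y) \<partial>N) / t\<^sup>2))"
    using mollify_grad_sq_le[OF t, of x] t by (intro mult_left_mono) auto
  also have "\<dots> \<le> t * (mollify N t x * ((2 * t * (mollify N t x
      * ln (gauss_density t (0 :: real ^ 'd) / mollify N t x))) / t\<^sup>2))"
    using t mollify_pos[OF t, of x]
    by (intro mult_left_mono divide_right_mono norm_sq_integral_le) auto
  finally show ?thesis using t by (simp add: power2_eq_square)
qed

end

text \<open>
  Above the cut-off, \<open>p *\<^sub>R (s' - s) = (p - p') *\<^sub>R s' + (g' - g)\<close>, which keeps the random \<open>p'\<close> out of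
  the denominator. Below it, either \<open>p\<close> is itself of order \<open>M / n\<close> or \<open>\<bar>p' - p\<bar> \<ge> p / 2\<close>; the latter
  is paid for by the variance, as in Chebyshev's inequality.
\<close>

lemma plugin_score_error:
  fixes g g' :: "'v::real_inner" and p p' M t :: real and n :: nat
  assumes n: "2 \<le> n" and t: "0 < t" and p: "0 < p" and p': "0 < p'" "p' \<le> M"
    and g: "t * (norm g)\<^sup>2 \<le> 2 * p\<^sup>2 * ln (M / p)"
    and g': "t * (norm g')\<^sup>2 \<le> 2 * p'\<^sup>2 * ln (M / p')"
  defines "e \<equiv> (norm ((if M / n \<le> p' then g' /\<^sub>R p' else 0) - g /\<^sub>R p))\<^sup>2 * p"
  shows plugin_score_error_bulk: "e \<le> 2 / p * (norm (g' - g))\<^sup>2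
      + 12 * ln n / (t * p) * (p' - p)\<^sup>2 + (4 * ln n + 2) * M / (n * t)" (is ?bulk)
    and plugin_score_error_tail: "e \<le> 4 * ln n / t * p + 2 * ((norm g)\<^sup>2 / p)" (is ?tail)
proof -
  have two: "(norm (u + v))\<^sup>2 \<le> 2 * (norm u)\<^sup>2 + 2 * (norm v)\<^sup>2" for u v :: 'v
  proof -
    have "(norm (u + v))\<^sup>2 \<le> (norm u + norm v)\<^sup>2" by (intro power_mono norm_triangle_ineq) auto
    also have "\<dots> \<le> 2 * (norm u)\<^sup>2 + 2 * (norm v)\<^sup>2"
      using zero_le_power2[of "norm u - norm v"] by (simp add: power2_eq_square algebra_simps)
    finally show ?thesis .
  qed
  define L where "L = ln (real n)"
  have L: "0 \<le> L" using n by (simp add: L_def)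
  have M: "0 < M" using p' by simp
  define s where "s = g /\<^sub>R p"
  define s' where "s' = (if M / n \<le> p' then g' /\<^sub>R p' else 0)"
  have e: "e = (norm (s' - s))\<^sup>2 * p" by (simp add: e_def s_def s'_def)
  have s: "(norm s)\<^sup>2 * p = (norm g)\<^sup>2 / p"
    using p by (simp add: s_def power_mult_distrib power2_eq_square field_simps)
  have s': "(norm s')\<^sup>2 \<le> 2 * L / t"
  proof (cases "M / n \<le> p'")
    case True
    have "t * (norm g')\<^sup>2 \<le> 2 * p'\<^sup>2 * ln (M / p')" by (rule g')
    also have "\<dots> \<le> 2 * p'\<^sup>2 * L"
    proof -
      have "M / p' \<le> n" using True p' n by (simp add: field_simps)
      thus ?thesis using M p' n unfolding L_def by (intro mult_left_mono) auto
    qed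
    finally show ?thesis
      using True t p' by (simp add: s'_def power_mult_distrib field_simps)
  qed (use L t in \<open>auto simp: s'_def\<close>)
  define a where "a = 2 / p * (norm (g' - g))\<^sup>2"
  define b where "b = L / (t * p) * (p' - p)\<^sup>2"
  define c where "c = L * M / (n * t)"
  define d where "d = M / (n * t)"
  have ge0: "0 \<le> a" "0 \<le> b" "0 \<le> c" "0 \<le> d"
    using p t L M by (auto simp: a_def b_def c_def d_def)
  \<comment> \<open>Naming the four contributions lets each case below end in linear arithmetic. The
    coefficient 12 covers the \<open>4 * b\<close> that arises above the cut-off and the
    \<open>8 * b\<close> that arises below it.\<close>
  have bulkI: ?bulk if "e \<le> a + 12 * b + (4 * c + 2 * d)"
    using that by (simp add: a_def b_def c_def d_def L_def algebra_simps add_divide_distrib)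
  show ?tail
  proof -
    have "e \<le> (2 * (norm s')\<^sup>2 + 2 * (norm s)\<^sup>2) * p"
      unfolding e using two[of s' "- s"] p by (intro mult_right_mono) auto
    also have "\<dots> = 2 * (norm s')\<^sup>2 * p + 2 * ((norm s)\<^sup>2 * p)" by (simp add: algebra_simps)
    also have "\<dots> \<le> 2 * (2 * L / t) * p + 2 * ((norm s)\<^sup>2 * p)"
      using s' p by (intro add_right_mono mult_right_mono mult_left_mono) auto
    finally show ?thesis unfolding s by (simp add: L_def)
  qed
  show ?bulk
  proof (cases "M / n \<le> p'")
    case True
    have gs: "g' = p' *\<^sub>R s'" "g = p *\<^sub>R s" using True p p' by (auto simp: s'_def s_def)
    have "p *\<^sub>R (s' - s) = (p - p') *\<^sub>R s' + (g' - g)"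
      by (simp add: gs algebra_simps)
    hence "(norm (p *\<^sub>R (s' - s)))\<^sup>2 \<le> 2 * (norm ((p - p') *\<^sub>R s'))\<^sup>2 + 2 * (norm (g' - g))\<^sup>2"
      using two by metis
    also have "\<dots> = 2 * (p' - p)\<^sup>2 * (norm s')\<^sup>2 + 2 * (norm (g' - g))\<^sup>2"
      by (simp add: power_mult_distrib power2_commute)
    also have "\<dots> \<le> 2 * (p' - p)\<^sup>2 * (2 * L / t) + 2 * (norm (g' - g))\<^sup>2"
      using s' by (intro add_right_mono mult_left_mono) auto
    finally have "p * e \<le> 4 * L / t * (p' - p)\<^sup>2 + 2 * (norm (g' - g))\<^sup>2"
      using p by (simp add: e power_mult_distrib power2_eq_square mult_ac)
    hence "e \<le> (4 * L / t * (p' - p)\<^sup>2 + 2 * (norm (g' - g))\<^sup>2) / p"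
      using p by (simp add: pos_le_divide_eq mult.commute)
    also have "\<dots> = 4 * b + a"
      using p t by (simp add: a_def b_def field_simps)
    finally show ?thesis using ge0 by (intro bulkI) linarith
  next
    case False
    hence e: "e = (norm g)\<^sup>2 / p" unfolding e s[symmetric] by (simp add: s'_def)
    have "t * (norm g)\<^sup>2 / (t * p) \<le> (2 * p\<^sup>2 * ln (M / p)) / (t * p)"
      using g t p by (intro divide_right_mono) auto
    hence e_le: "e \<le> 2 / t * (p * ln (M / p))"
      using t p by (simp add: e power2_eq_square)
    show ?thesis
    \<comment> \<open>Here \<open>p' < M / n\<close>, so a threshold of twice the cut-off is what
      forces \<open>p'\<close> below \<open>p / 2\<close>.\<close>
    proof (cases "2 * M / n \<le> p")
      case large: True
      have "M / p \<le> n" using large p n M by (simp add: field_simps)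
      hence "ln (M / p) \<le> L" using M p n by (simp add: L_def)
      hence "p * ln (M / p) \<le> p * L" using p by (intro mult_left_mono) auto
      moreover have "p\<^sup>2 \<le> (2 * (p - p'))\<^sup>2"
        using False large p p' by (intro power_mono) auto
      hence "p * p \<le> 4 * (p' - p)\<^sup>2" by (simp add: power2_eq_square algebra_simps)
      hence "p \<le> 4 * (p' - p)\<^sup>2 / p" using p by (simp add: pos_le_divide_eq)
      hence "p * L \<le> 4 * (p' - p)\<^sup>2 / p * L" using L by (intro mult_right_mono)
      ultimately have "2 / t * (p * ln (M / p)) \<le> 2 / t * (4 * (p' - p)\<^sup>2 / p * L)"
        using t by (intro mult_left_mono) auto
      also have "\<dots> = 8 * b" using t p by (simp add: b_def field_simps)
      finally show ?thesis using ge0 e_le by (intro bulkI) linarith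
    next
      case small: False
      \<comment> \<open>Splitting off \<open>ln n\<close> leaves a logarithm that is harmless
        however small \<open>p\<close> is: \<open>p * ln (M / (n * p))\<close> is at most
        \<open>M / n\<close>.\<close>
      have "ln (M / p) = L + ln (M / (n * p))"
        using M p n by (simp add: L_def ln_div ln_mult)
      moreover have "ln (M / (n * p)) \<le> M / (n * p)"
        using ln_le_minus_one[of "M / (n * p)"] M p n by auto
      ultimately have "p * ln (M / p) \<le> p * (L + M / (n * p))"
        using p by (intro mult_left_mono) auto
      also have "\<dots> = p * L + M / n" using p by (simp add: field_simps)
      also have "\<dots> \<le> 2 * M / n * L + M / n"
        using small L by (intro add_right_mono mult_right_mono) auto
      finally have "2 / t * (p * ln (M / p)) \<le> 2 / t * (2 * M / n * L + M / n)"
        using t by (intro mult_left_mono) auto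
      also have "\<dots> = 4 * c + 2 * d"
        using t n by (simp add: c_def d_def field_simps)
      finally show ?thesis using ge0 e_le by (intro bulkI) linarith
    qed
  qed
qed

section \<open>The truncated kernel estimator\<close>

lemma borel_measurable_vec_nth [measurable]: "(\<lambda>v :: real ^ 'd. v $ k) \<in> borel_measurable borel"
  by (intro borel_measurable_continuous_onI continuous_intros)

text \<open>As the image of a uniform index it is a genuine probability measure, so everything
  proved in \<open>borel_prob\<close> holds for the kernel density estimate, sample by
  sample.\<close>

definition empirical :: "nat \<Rightarrow> (nat \<Rightarrow> real ^ 'd) \<Rightarrow> (real ^ 'd) measure" where
  "empirical n xs = distr (measure_pmf (pmf_of_set {..<n})) borel xs"

lemma borel_prob_empirical: "borel_prob (empirical n xs)"
  unfolding borel_prob_def borel_prob_axioms_def empirical_def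
  by (auto intro!: measure_pmf.prob_space_distr)

lemma integral_empirical:
  fixes f :: "real ^ 'd \<Rightarrow> 'b::{banach, second_countable_topology}"
  assumes [measurable]: "f \<in> borel_measurable borel" and n: "0 < n"
  shows "(\<integral>y. f y \<partial>empirical n xs) = (\<Sum>i<n. f (xs i)) /\<^sub>R n"
proof -
  have "(\<integral>y. f y \<partial>empirical n xs) = (\<integral>i. f (xs i) \<partial>measure_pmf (pmf_of_set {..<n}))"
    unfolding empirical_def by (rule integral_distr) auto
  also have "\<dots> = (\<Sum>i<n. pmf (pmf_of_set {..<n}) i *\<^sub>R f (xs i))"
    using n by (intro integral_measure_pmf) (auto simp: set_pmf_of_set lessThan_empty_iff)
  also have "\<dots> = (\<Sum>i<n. f (xs i) /\<^sub>R n)"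
    using n by (intro sum.cong) (auto simp: pmf_of_set lessThan_empty_iff divide_inverse)
  finally show ?thesis by (simp add: scaleR_sum_right)
qed

lemma mollify_empirical:
  "0 < n \<Longrightarrow> mollify (empirical n xs) t x = (\<Sum>i<n. gauss_density t (x - xs i)) /\<^sub>R n"
  unfolding mollify_def by (rule integral_empirical) auto

lemma mollify_grad_empirical:
  "0 < n \<Longrightarrow> mollify_grad (empirical n xs) t x = (\<Sum>i<n. gauss_grad t (x - xs i)) /\<^sub>R n"
  unfolding mollify_grad_def by (rule integral_empirical) auto

lemma measurable_pair_mollify_empirical [measurable]:
  "0 < n \<Longrightarrow> (\<lambda>z. mollify (empirical n (fst z)) t (snd z))
     \<in> borel_measurable (Pi\<^sub>M {..<n} (\<lambda>_. borel) \<Otimes>\<^sub>M borel)"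
  by (simp add: mollify_empirical) measurable

lemma measurable_pair_mollify_grad_empirical [measurable]:
  "0 < n \<Longrightarrow> (\<lambda>z. mollify_grad (empirical n (fst z)) t (snd z))
     \<in> borel_measurable (Pi\<^sub>M {..<n} (\<lambda>_. borel) \<Otimes>\<^sub>M borel)"
  by (simp add: mollify_grad_empirical) measurable

text \<open>
  Since \<open>t * (norm s)\<^sup>2 \<le> 2 * ln (M / p)\<close> for the score \<open>s\<close> of any Gaussian mixture \<open>p\<close> with peak value
  \<open>M = gauss_density t 0\<close>, the cut-off at \<open>M / n\<close> keeps the estimator bounded by \<open>2 * ln n / t\<close> in square.
\<close>

definition kde_score :: "nat \<Rightarrow> real \<Rightarrow> (nat \<Rightarrow> real ^ 'd) \<Rightarrow> real ^ 'd \<Rightarrow> real ^ 'd" where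
  "kde_score n t xs x =
     (if gauss_density t (0 :: real ^ 'd) / n \<le> mollify (empirical n xs) t x
      then mollify_grad (empirical n xs) t x /\<^sub>R mollify (empirical n xs) t x else 0)"

lemma measurable_pair_kde_score [measurable]:
  assumes [simp]: "0 < n"
  shows "(\<lambda>z. kde_score n t (fst z) (snd z))
     \<in> borel_measurable (Pi\<^sub>M {..<n} (\<lambda>_. borel) \<Otimes>\<^sub>M borel)"
  unfolding kde_score_def by measurable

section \<open>Mean squared errors of sample means\<close>

context prob_space
begin

text \<open>Independence of two coordinates, obtained by padding the product with factors 1 in the
  other coordinates so that the integral over the product measure factorises.\<close>

lemma expectation_prod_PiM_two:
  fixes f :: "'a \<Rightarrow> real" and i j n :: nat
  assumes f: "f \<in> borel_measurable M" "\<And>x. \<bar>f x\<bar> \<le> B" and "expectation f = 0"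
    and ij: "i < n" "j < n" "i \<noteq> j"
  shows "(\<integral>xs. f (xs i) * f (xs j) \<partial>Pi\<^sub>M {..<n} (\<lambda>_. M)) = 0"
proof -
  interpret P: product_sigma_finite "\<lambda>_::nat. M" by standard
  define h where "h k = (if k = i \<or> k = j then f else (\<lambda>_. 1))" for k
  have "(\<Prod>k<n. h k (xs k)) = f (xs i) * f (xs j)" for xs
  proof -
    have "(\<Prod>k<n. h k (xs k)) = (\<Prod>k\<in>{i, j}. h k (xs k))"
      using ij by (intro prod.mono_neutral_right) (auto simp: h_def)
    thus ?thesis using ij by (simp add: h_def)
  qed
  hence "(\<integral>xs. f (xs i) * f (xs j) \<partial>Pi\<^sub>M {..<n} (\<lambda>_. M)) = (\<Prod>k<n. expectation (h k))"
    using f by (subst P.product_integral_prod[symmetric])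
      (auto simp: h_def intro!: integrable_const_bound[where B = B])
  also have "\<dots> = 0" using assms by (intro prod_zero) (auto simp: h_def)
  finally show ?thesis .
qed

text \<open>After centring, the square of the sum expands into a double sum whose off-diagonal terms
  vanish by independence. The variance left on the diagonal is relaxed to the second moment, which
  is what the kernel bounds control.\<close>

lemma sample_mean_mse:
  fixes f :: "'a \<Rightarrow> real" and n :: nat
  assumes f [measurable]: "f \<in> borel_measurable M" and B: "\<And>x. \<bar>f x\<bar> \<le> B" and n: "0 < n"
  shows "(\<integral>\<^sup>+ xs. ennreal (((\<Sum>i<n. f (xs i)) / n - expectation f)\<^sup>2) \<partial>Pi\<^sub>M {..<n} (\<lambda>_. M))
      \<le> ennreal (expectation (\<lambda>x. (f x)\<^sup>2) / n)"
proof -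
  define g where "g x = f x - expectation f" for x
  define B' where "B' = B + \<bar>expectation f\<bar>"
  have [measurable]: "g \<in> borel_measurable M" by (simp add: g_def[abs_def])
  have B': "\<bar>g x\<bar> \<le> B'" for x using B[of x] unfolding g_def B'_def by linarith
  have int: "integrable M f" using B by (intro integrable_const_bound[where B = B]) auto
  have int2: "integrable M (\<lambda>x. (f x)\<^sup>2)"
    using power_mono[OF B, where n = 2] by (intro integrable_const_bound[where B = "B\<^sup>2"]) auto
  interpret P: prob_space "Pi\<^sub>M {..<n} (\<lambda>_. M)" by (intro prob_space_PiM prob_space_axioms)
  have int_g: "integrable (Pi\<^sub>M {..<n} (\<lambda>_. M)) (\<lambda>xs. g (xs i) * g (xs j))" if "i < n" "j < n" for i j
    using that B' by (intro P.integrable_const_bound[where B = "B' * B'"])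
      (auto simp: abs_mult intro!: AE_I2 mult_mono order.trans[OF abs_ge_zero B'])
  have sq: "((\<Sum>i<n. f (xs i)) / n - expectation f)\<^sup>2 = (\<Sum>i<n. \<Sum>j<n. g (xs i) * g (xs j)) / n\<^sup>2" for xs
  proof -
    have "(\<Sum>i<n. f (xs i)) / n - expectation f = (\<Sum>i<n. g (xs i)) / n"
      using n by (simp add: g_def sum_subtractf diff_divide_distrib)
    thus ?thesis by (simp add: power_divide power2_eq_square sum_product)
  qed
  have diag: "(\<integral>xs. g (xs i) * g (xs i) \<partial>Pi\<^sub>M {..<n} (\<lambda>_. M)) = expectation (\<lambda>x. (g x)\<^sup>2)" if "i < n" for i
  proof -
    have "expectation (\<lambda>x. (g x)\<^sup>2)
        = (\<integral>x. (g x)\<^sup>2 \<partial>distr (Pi\<^sub>M {..<n} (\<lambda>_. M)) M (\<lambda>xs. xs i))"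
      using that by (subst distr_PiM_component) (auto intro: prob_space_axioms)
    also have "\<dots> = (\<integral>xs. (g (xs i))\<^sup>2 \<partial>Pi\<^sub>M {..<n} (\<lambda>_. M))"
      using that by (intro integral_distr) auto
    finally show ?thesis by (simp add: power2_eq_square)
  qed
  have "(\<integral>xs. ((\<Sum>i<n. f (xs i)) / n - expectation f)\<^sup>2 \<partial>Pi\<^sub>M {..<n} (\<lambda>_. M))
      = (\<Sum>i<n. \<Sum>j<n. \<integral>xs. g (xs i) * g (xs j) \<partial>Pi\<^sub>M {..<n} (\<lambda>_. M)) / n\<^sup>2"
  proof -
    have "(\<integral>xs. (\<Sum>i<n. \<Sum>j<n. g (xs i) * g (xs j)) \<partial>Pi\<^sub>M {..<n} (\<lambda>_. M))
        = (\<Sum>i<n. \<integral>xs. (\<Sum>j<n. g (xs i) * g (xs j)) \<partial>Pi\<^sub>M {..<n} (\<lambda>_. M))"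
      using int_g by (intro Bochner_Integration.integral_sum Bochner_Integration.integrable_sum) auto
    also have "\<dots> = (\<Sum>i<n. \<Sum>j<n. \<integral>xs. g (xs i) * g (xs j) \<partial>Pi\<^sub>M {..<n} (\<lambda>_. M))"
      using int_g by (intro sum.cong refl Bochner_Integration.integral_sum) auto
    finally show ?thesis unfolding sq by simp
  qed
  also have "\<dots> = (\<Sum>i<n. \<Sum>j<n. if j = i then expectation (\<lambda>x. (g x)\<^sup>2) else 0) / n\<^sup>2"
  proof -
    have "expectation g = 0" using int by (simp add: g_def[abs_def] prob_space)
    hence "(\<integral>xs. g (xs i) * g (xs j) \<partial>Pi\<^sub>M {..<n} (\<lambda>_. M)) = 0" if "i < n" "j < n" "i \<noteq> j" for i j
      using that B' by (intro expectation_prod_PiM_two[where B = B']) auto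
    thus ?thesis using diag by (intro arg_cong2[where f = "(/)"] sum.cong refl) auto
  qed
  also have "\<dots> = expectation (\<lambda>x. (g x)\<^sup>2) / n" using n by (simp add: power2_eq_square)
  also have "expectation (\<lambda>x. (g x)\<^sup>2) = expectation (\<lambda>x. (f x)\<^sup>2) - (expectation f)\<^sup>2"
    unfolding g_def using int int2 by (rule variance_eq)
  also have "(expectation (\<lambda>x. (f x)\<^sup>2) - (expectation f)\<^sup>2) / n \<le> expectation (\<lambda>x. (f x)\<^sup>2) / n"
    by (intro divide_right_mono) auto
  finally have le: "(\<integral>xs. ((\<Sum>i<n. f (xs i)) / n - expectation f)\<^sup>2 \<partial>Pi\<^sub>M {..<n} (\<lambda>_. M))
      \<le> expectation (\<lambda>x. (f x)\<^sup>2) / n" .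
  have "integrable (Pi\<^sub>M {..<n} (\<lambda>_. M)) (\<lambda>xs. ((\<Sum>i<n. f (xs i)) / n - expectation f)\<^sup>2)"
    unfolding sq using int_g
    by (intro integrable_divide Bochner_Integration.integrable_sum) auto
  thus ?thesis using le by (subst nn_integral_eq_integral) (auto intro!: ennreal_leI)
qed

end

context borel_prob
begin

text \<open>The squared kernel is at most its peak times itself, hence a variance proportional to
  the mixture. This cancels the \<open>1 / p\<close> in
  \<open>plugin_score_error_bulk\<close>.\<close>

lemma mollify_mse:
  assumes t: "0 < t" and n: "0 < n"
  shows "(\<integral>\<^sup>+ xs. ennreal ((mollify (empirical n xs) t x - mollify N t x)\<^sup>2) \<partial>Pi\<^sub>M {..<n} (\<lambda>_. N))
      \<le> ennreal (gauss_density t (0 :: real ^ 'd) * mollify N t x / n)"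
proof -
  let ?f = "\<lambda>y. gauss_density t (x - y)" and ?M = "gauss_density t (0 :: real ^ 'd)"
  have "(\<integral>\<^sup>+ xs. ennreal ((mollify (empirical n xs) t x - mollify N t x)\<^sup>2) \<partial>Pi\<^sub>M {..<n} (\<lambda>_. N))
      = (\<integral>\<^sup>+ xs. ennreal (((\<Sum>i<n. ?f (xs i)) / n - expectation ?f)\<^sup>2) \<partial>Pi\<^sub>M {..<n} (\<lambda>_. N))"
    using n by (simp add: mollify_empirical divide_inverse mult.commute) (simp add: mollify_def)
  also have "\<dots> \<le> ennreal (expectation (\<lambda>y. (?f y)\<^sup>2) / n)"
    using n t by (intro sample_mean_mse[where B = ?M]) (auto simp: gauss_density_le)
  also have "expectation (\<lambda>y. (?f y)\<^sup>2) \<le> expectation (\<lambda>y. ?M * ?f y)"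
  proof (rule Bochner_Integration.integral_mono)
    show "integrable N (\<lambda>y. (?f y)\<^sup>2)"
      using t by (intro integrable_const_bound[where B = "?M\<^sup>2"])
        (auto intro!: power_mono gauss_density_le)
    show "(?f y)\<^sup>2 \<le> ?M * ?f y" for y
      using t by (auto simp: power2_eq_square gauss_density_le intro!: mult_right_mono)
  qed (use t in auto)
  also have "expectation (\<lambda>y. ?M * ?f y) = ?M * mollify N t x" using t by (simp add: mollify_def)
  finally show ?thesis by (simp add: divide_right_mono ennreal_leI)
qed

text \<open>The scalar bound is applied to each coordinate. The second moments add up to that of the
  norm, so no factor of the dimension is lost.\<close>

lemma mollify_grad_mse:
  assumes t: "0 < t" and n: "0 < n"
  shows "(\<integral>\<^sup>+ xs. ennreal ((norm (mollify_grad (empirical n xs) t x - mollify_grad N t x))\<^sup>2)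
      \<partial>Pi\<^sub>M {..<n} (\<lambda>_. N)) \<le> ennreal (gauss_density t (0 :: real ^ 'd) / t * mollify N t x / n)"
proof -
  let ?f = "\<lambda>k y. gauss_grad t (x - y) $ k" and ?M = "gauss_density t (0 :: real ^ 'd)"
  have nsq: "(norm v)\<^sup>2 = (\<Sum>k\<in>UNIV. (v $ k)\<^sup>2)" for v :: "real ^ 'd"
    unfolding power2_norm_eq_inner by (simp add: inner_vec_def power2_eq_square)
  have comp: "mollify_grad N t x $ k = expectation (?f k)" for k
    unfolding mollify_grad_def using t
    by (intro integral_bounded_linear[symmetric] bounded_linear_vec_nth) auto
  have bound: "\<bar>?f k y\<bar> \<le> ?M / sqrt t" for k y
    using component_le_norm_cart[of "gauss_grad t (x - y)" k] norm_gauss_grad_le[OF t, of "x - y"]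
    by linarith
  have intk: "integrable N (\<lambda>y. (?f k y)\<^sup>2)" for k
    using power_mono[OF bound, where n = 2]
    by (intro integrable_const_bound[where B = "(?M / sqrt t)\<^sup>2"]) auto
  have "(\<integral>\<^sup>+ xs. ennreal ((norm (mollify_grad (empirical n xs) t x - mollify_grad N t x))\<^sup>2)
        \<partial>Pi\<^sub>M {..<n} (\<lambda>_. N))
      = (\<integral>\<^sup>+ xs. (\<Sum>k\<in>UNIV. ennreal (((\<Sum>i<n. ?f k (xs i)) / n - expectation (?f k))\<^sup>2))
        \<partial>Pi\<^sub>M {..<n} (\<lambda>_. N))"
    using n by (simp add: nsq mollify_grad_empirical divide_inverse mult.commute comp)
  also have "\<dots> = (\<Sum>k\<in>UNIV. \<integral>\<^sup>+ xs. ennreal (((\<Sum>i<n. ?f k (xs i)) / n - expectation (?f k))\<^sup>2)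
        \<partial>Pi\<^sub>M {..<n} (\<lambda>_. N))"
    by (rule nn_integral_sum) measurable
  also have "\<dots> \<le> (\<Sum>k\<in>UNIV. ennreal (expectation (\<lambda>y. (?f k y)\<^sup>2) / n))"
    using n bound by (intro sum_mono sample_mean_mse[where B = "?M / sqrt t"]) auto
  also have "\<dots> = ennreal ((\<Sum>k\<in>UNIV. expectation (\<lambda>y. (?f k y)\<^sup>2)) / n)"
    by (simp add: sum_divide_distrib)
  also have "(\<Sum>k\<in>UNIV. expectation (\<lambda>y. (?f k y)\<^sup>2)) = expectation (\<lambda>y. (norm (gauss_grad t (x - y)))\<^sup>2)"
    using intk by (simp add: nsq Bochner_Integration.integral_sum)
  also have "\<dots> \<le> expectation (\<lambda>y. ?M / t * gauss_density t (x - y))"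
  proof (rule Bochner_Integration.integral_mono)
    show "integrable N (\<lambda>y. (norm (gauss_grad t (x - y)))\<^sup>2)" using intk by (simp add: nsq)
  qed (use t norm_gauss_grad_sq_le in auto)
  also have "\<dots> = ?M / t * mollify N t x" using t by (simp add: mollify_def)
  finally show ?thesis by (simp add: divide_right_mono ennreal_leI)
qed

end

section \<open>Sub-Gaussian tails\<close>

lemma psi2_norm_coord:
  assumes "sub_gaussian M X \<sigma>"
  shows "psi2_norm M (\<lambda>w. X w $ k) \<le> ennreal \<sigma>"
proof -
  have "psi2_norm M (\<lambda>w. X w \<bullet> axis k 1) \<le> psi2_norm_vec M X"
    unfolding psi2_norm_vec_def by (intro SUP_upper) simp
  thus ?thesis using assms by (simp add: sub_gaussian_def inner_axis)
qed

text \<open>The infimum need not be attained, so an admissible constant is extracted only below a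
  strictly larger \<open>c\<close>.\<close>

lemma psi2_norm_less_ennrealE:
  assumes "psi2_norm M Y < ennreal c"
  obtains C where "0 < C" "C < c" "(\<integral>\<^sup>+ w. ennreal (exp ((Y w)\<^sup>2 / C\<^sup>2) - 1) \<partial>M) \<le> 1"
proof -
  from assms obtain C where C: "ennreal C < ennreal c" "0 < C"
      "(\<integral>\<^sup>+ w. ennreal (exp ((Y w)\<^sup>2 / C\<^sup>2) - 1) \<partial>M) \<le> 1"
    unfolding psi2_norm_def Inf_less_iff by auto
  moreover from C have "C < c" by (simp add: ennreal_less_iff)
  ultimately show thesis using that by blast
qed

lemma AE_lborel_coord_neq_0: "AE x in lborel. (x :: real ^ 'd) $ k \<noteq> 0"
proof -
  have "negligible {x :: real ^ 'd. axis k 1 \<bullet> x = 0}"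
    by (rule negligible_hyperplane) (simp add: axis_eq_0_iff)
  hence "{x :: real ^ 'd. x $ k = 0} \<in> null_sets (completion lborel)"
    by (simp add: negligible_iff_null_sets inner_axis')
  moreover have "{x :: real ^ 'd. x $ k = 0} \<in> sets lborel" by measurable
  ultimately have "{x :: real ^ 'd. x $ k = 0} \<in> null_sets lborel"
    by (simp add: null_sets_completion_iff)
  from AE_not_in[OF this] show ?thesis by simp
qed

text \<open>A random vector with a density cannot be concentrated on a hyperplane.\<close>

lemma sub_gaussian_density_pos:
  fixes p :: "real ^ 'd \<Rightarrow> real"
  assumes p: "probability_density p" and sg: "sub_gaussian (law p) (\<lambda>x. x) \<sigma>"
  shows "0 < \<sigma>"
proof (rule ccontr)
  assume "\<not> 0 < \<sigma>"
  hence [simp]: "\<sigma> = 0" using sg by (simp add: sub_gaussian_def)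
  interpret borel_prob "law p" by (rule borel_prob_law[OF p])
  fix k :: 'd
  \<comment> \<open>With norm 0 the admissible \<open>C\<close> can be taken arbitrarily small. The
    bound of \<open>C^2 * (exp (y^2 / C^2) - 1)\<close> below by \<open>y^2\<close> then makes the
    second moment of the coordinate at most \<open>C^2\<close>.\<close>
  have "(\<integral>\<^sup>+ x. ennreal ((x $ k)\<^sup>2) \<partial>law p) \<le> 0"
  proof (rule ennreal_le_epsilon)
    fix e :: real assume e: "0 < e"
    have "psi2_norm (law p) (\<lambda>x. x $ k) \<le> ennreal 0" using psi2_norm_coord[OF sg, of k] by simp
    also have "\<dots> < ennreal (sqrt e)" using e by simp
    finally obtain C where C: "0 < C" "C < sqrt e"
      "(\<integral>\<^sup>+ x. ennreal (exp ((x $ k)\<^sup>2 / C\<^sup>2) - 1) \<partial>law p) \<le> 1"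
      by (rule psi2_norm_less_ennrealE)
    have "(\<integral>\<^sup>+ x. ennreal ((x $ k)\<^sup>2) \<partial>law p)
        \<le> (\<integral>\<^sup>+ x. ennreal (C\<^sup>2) * ennreal (exp ((x $ k)\<^sup>2 / C\<^sup>2) - 1) \<partial>law p)"
    proof (rule nn_integral_mono)
      fix x :: "real ^ 'd"
      have "C\<^sup>2 * ((x $ k)\<^sup>2 / C\<^sup>2) \<le> C\<^sup>2 * (exp ((x $ k)\<^sup>2 / C\<^sup>2) - 1)"
        using exp_ge_add_one_self[of "(x $ k)\<^sup>2 / C\<^sup>2"] by (intro mult_left_mono) (linarith, simp)
      thus "ennreal ((x $ k)\<^sup>2) \<le> ennreal (C\<^sup>2) * ennreal (exp ((x $ k)\<^sup>2 / C\<^sup>2) - 1)"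
        using C by (subst ennreal_mult'[symmetric]) (auto intro!: ennreal_leI)
    qed
    also have "\<dots> = ennreal (C\<^sup>2) * (\<integral>\<^sup>+ x. ennreal (exp ((x $ k)\<^sup>2 / C\<^sup>2) - 1) \<partial>law p)"
      by (intro nn_integral_cmult) measurable
    also have "\<dots> \<le> ennreal (C\<^sup>2) * 1" using C by (intro mult_left_mono) auto
    also have "C\<^sup>2 \<le> (sqrt e)\<^sup>2" using C by (intro power_mono) auto
    hence "ennreal (C\<^sup>2) * 1 \<le> ennreal e" using e by (simp add: ennreal_leI)
    finally show "(\<integral>\<^sup>+ x. ennreal ((x $ k)\<^sup>2) \<partial>law p) \<le> 0 + ennreal e" by simp
  qed
  hence "AE x in law p. ennreal ((x $ k)\<^sup>2) = 0"
    by (subst (asm) le_zero_eq, subst (asm) nn_integral_0_iff_AE) measurable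
  hence "AE x in lborel. 0 < ennreal (p x) \<longrightarrow> x $ k = 0"
    unfolding law_def using p
    by (subst (asm) AE_density) (auto simp: probability_density_def elim!: eventually_mono)
  hence "AE x in lborel. 0 < ennreal (p x) \<longrightarrow> False"
    using AE_lborel_coord_neq_0[of k] by eventually_elim auto
  hence "AE x in law p. False"
    unfolding law_def using p by (subst AE_density) (auto simp: probability_density_def)
  thus False by simp
qed

text \<open>The squared norm is at most the dimension times the largest squared coordinate, and the
  exponential of a maximum is at most the sum of the exponentials. So the coordinate bounds suffice
  whatever the dependence between coordinates, each contributing 1 + 1 to the moment.\<close>

lemma sub_gaussian_exp_moment:
  fixes X :: "'w \<Rightarrow> real ^ 'd"
  assumes M: "prob_space M" and [measurable]: "X \<in> borel_measurable M" and sg: "sub_gaussian M X \<sigma>"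
  obtains K where "0 < K"
    "(\<integral>\<^sup>+ w. ennreal (exp ((norm (X w))\<^sup>2 / K)) \<partial>M) \<le> ennreal (2 * CARD('d))"
proof -
  interpret prob_space M by (rule M)
  have "\<exists>C. 0 < C \<and> (\<integral>\<^sup>+ w. ennreal (exp ((X w $ k)\<^sup>2 / C\<^sup>2) - 1) \<partial>M) \<le> 1" for k
  proof -
    have "psi2_norm M (\<lambda>w. X w $ k) \<le> ennreal \<sigma>" by (rule psi2_norm_coord[OF sg])
    also have "\<dots> < ennreal (\<sigma> + 1)" using sg by (simp add: sub_gaussian_def ennreal_less_iff)
    finally show ?thesis by (rule psi2_norm_less_ennrealE) auto
  qed
  then obtain C where C: "\<And>k. 0 < C k"
      "\<And>k. (\<integral>\<^sup>+ w. ennreal (exp ((X w $ k)\<^sup>2 / (C k)\<^sup>2) - 1) \<partial>M) \<le> 1"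
    by metis
  define S where "S = (\<Sum>k\<in>UNIV. C k)"
  have CS: "C k \<le> S" for k
    unfolding S_def using C(1) by (intro member_le_sum) (auto simp: less_imp_le)
  have S: "0 < S" using C(1) CS less_le_trans by blast
  \<comment> \<open>\<open>S\<close> dominates every coordinate constant, and the factor
    \<open>CARD('d)\<close> pays for replacing the sum of squares by its largest term.\<close>
  define K where "K = CARD('d) * S\<^sup>2"
  have pointwise: "exp ((norm x)\<^sup>2 / K) \<le> (\<Sum>k\<in>UNIV. exp ((x $ k)\<^sup>2 / (C k)\<^sup>2))" for x :: "real ^ 'd"
  proof -
    define m where "m = Max (range (\<lambda>k. (x $ k)\<^sup>2))"
    have "m \<in> range (\<lambda>k. (x $ k)\<^sup>2)" unfolding m_def by (intro Max_in) auto
    then obtain k where k: "m = (x $ k)\<^sup>2" by blast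
    have "(norm x)\<^sup>2 = (\<Sum>j\<in>UNIV. (x $ j)\<^sup>2)"
      unfolding power2_norm_eq_inner by (simp add: inner_vec_def power2_eq_square)
    also have "\<dots> \<le> (\<Sum>j\<in>(UNIV :: 'd set). m)" unfolding m_def by (intro sum_mono Max_ge) auto
    finally have "(norm x)\<^sup>2 / K \<le> (CARD('d) * m) / K"
      using S by (intro divide_right_mono) (auto simp: K_def)
    also have "\<dots> = (x $ k)\<^sup>2 / S\<^sup>2" by (simp add: K_def k)
    also have "\<dots> \<le> (x $ k)\<^sup>2 / (C k)\<^sup>2"
      using C(1)[of k] CS[of k] by (intro divide_left_mono power_mono mult_pos_pos) auto
    finally have "exp ((norm x)\<^sup>2 / K) \<le> exp ((x $ k)\<^sup>2 / (C k)\<^sup>2)" by simp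
    also have "\<dots> \<le> (\<Sum>k\<in>UNIV. exp ((x $ k)\<^sup>2 / (C k)\<^sup>2))"
      by (intro member_le_sum) auto
    finally show ?thesis .
  qed
  have "(\<integral>\<^sup>+ w. ennreal (exp ((norm (X w))\<^sup>2 / K)) \<partial>M)
      \<le> (\<integral>\<^sup>+ w. (\<Sum>k\<in>UNIV. (ennreal (exp ((X w $ k)\<^sup>2 / (C k)\<^sup>2) - 1) + 1)) \<partial>M)"
  proof (rule nn_integral_mono)
    fix w
    have "ennreal (exp ((norm (X w))\<^sup>2 / K)) \<le> ennreal (\<Sum>k\<in>UNIV. exp ((X w $ k)\<^sup>2 / (C k)\<^sup>2))"
      by (intro ennreal_leI pointwise)
    also have "\<dots> = (\<Sum>k\<in>UNIV. ennreal (exp ((X w $ k)\<^sup>2 / (C k)\<^sup>2) - 1 + 1))"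
      by (simp del: ennreal_plus)
    also have "\<dots> = (\<Sum>k\<in>UNIV. (ennreal (exp ((X w $ k)\<^sup>2 / (C k)\<^sup>2) - 1) + 1))"
      by (intro sum.cong refl, subst ennreal_plus) auto
    finally show "ennreal (exp ((norm (X w))\<^sup>2 / K))
        \<le> (\<Sum>k\<in>UNIV. (ennreal (exp ((X w $ k)\<^sup>2 / (C k)\<^sup>2) - 1) + 1))" .
  qed
  also have "\<dots> = (\<Sum>k\<in>UNIV. (\<integral>\<^sup>+ w. ennreal (exp ((X w $ k)\<^sup>2 / (C k)\<^sup>2) - 1) \<partial>M) + 1)"
    by (subst nn_integral_sum) (auto simp: nn_integral_add emeasure_space_1)
  also have "\<dots> \<le> (\<Sum>k\<in>(UNIV :: 'd set). 1 + 1)" by (intro sum_mono add_right_mono C)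
  also have "\<dots> = ennreal (2 * CARD('d))"
    by (simp add: ennreal_mult ennreal_of_nat_eq_real_of_nat mult.commute)
  finally show thesis using S by (intro that[of K]) (auto simp: K_def)
qed

section \<open>Normalisation and tail integrals of the Gaussian kernel\<close>

lemma nn_integral_gauss_density:
  assumes t: "0 < t"
  shows "(\<integral>\<^sup>+ x. ennreal (gauss_density t (x :: real ^ 'd)) \<partial>lborel) = 1"
proof -
  have "gauss_density t x = (\<Prod>b\<in>Basis. normal_density 0 (sqrt t) (x \<bullet> b))" for x :: "real ^ 'd"
  proof -
    have "(\<Prod>b\<in>Basis. normal_density 0 (sqrt t) (x \<bullet> b))
        = (1 / sqrt (2 * pi * t)) ^ CARD('d) * exp (\<Sum>b\<in>Basis. - (x \<bullet> b)\<^sup>2 / (2 * t))"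
      using t by (simp add: normal_density_def prod.distrib exp_sum prod_dividef power_divide)
    also have "(\<Sum>b\<in>Basis. - (x \<bullet> b)\<^sup>2 / (2 * t)) = - (norm x)\<^sup>2 / (2 * t)"
      unfolding power2_norm_eq_inner euclidean_inner[of x x]
      by (simp add: sum_negf sum_divide_distrib power2_eq_square)
    also have "(1 / sqrt (2 * pi * t)) ^ CARD('d) = (2 * pi * t) powr (- real CARD('d) / 2)"
    proof -
      have "1 / sqrt (2 * pi * t) = (2 * pi * t) powr (- (1 / 2))"
        unfolding powr_minus using t by (simp add: powr_half_sqrt inverse_eq_divide)
      moreover have "((2 * pi * t) powr (- (1 / 2))) ^ CARD('d)
          = ((2 * pi * t) powr (- (1 / 2))) powr real CARD('d)"
        by (rule powr_realpow[symmetric]) (use t in simp)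
      ultimately show ?thesis by (simp only: powr_powr) simp
    qed
    finally show ?thesis unfolding gauss_density_def by (rule sym)
  qed
  hence "(\<integral>\<^sup>+ x. ennreal (gauss_density t (x :: real ^ 'd)) \<partial>lborel)
      = (\<integral>\<^sup>+ x. (\<Prod>b\<in>(Basis :: (real ^ 'd) set). ennreal (normal_density 0 (sqrt t) (x \<bullet> b))) \<partial>lborel)"
    by (simp add: prod_ennreal)
  also have "\<dots> = (\<Prod>b\<in>(Basis :: (real ^ 'd) set). \<integral>\<^sup>+ x. ennreal (normal_density 0 (sqrt t) x) \<partial>lborel)"
    by (rule nn_integral_lborel_prod) auto
  also have "(\<integral>\<^sup>+ x. ennreal (normal_density 0 (sqrt t) x) \<partial>lborel) = 1"
    using t by (subst nn_integral_eq_integral) auto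
  finally show ?thesis by simp
qed

lemma nn_integral_gauss_density_shift:
  assumes t: "0 < t"
  shows "(\<integral>\<^sup>+ x. ennreal (gauss_density t (x - y :: real ^ 'd)) \<partial>lborel) = 1"
proof -
  have "(\<integral>\<^sup>+ x. ennreal (gauss_density t (x - y)) \<partial>lborel)
      = (\<integral>\<^sup>+ x. ennreal (gauss_density t (x - y)) \<partial>distr lborel borel ((+) y))"
    by (simp add: lborel_distr_plus)
  also have "\<dots> = (\<integral>\<^sup>+ x. ennreal (gauss_density t (x :: real ^ 'd)) \<partial>lborel)"
    by (subst nn_integral_distr) (auto simp: add.commute)
  finally show ?thesis by (simp add: nn_integral_gauss_density t)
qed

text \<open>Half of the Gaussian exponent absorbs an exponential weight; what remains is a multiple
  of the kernel of twice the variance, which still integrates to one.\<close>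

lemma gauss_density_double:
  "exp ((norm z)\<^sup>2 / (4 * t)) * gauss_density t z
     = 2 powr (real CARD('d) / 2) * gauss_density (2 * t) z"
  if t: "0 < t" for z :: "real ^ 'd"
proof -
  define q where "q = real CARD('d) / 2"
  have "2 * pi * (2 * t) = 2 * (2 * pi * t)" by simp
  hence "(2 * pi * (2 * t)) powr - q = 2 powr - q * (2 * pi * t) powr - q"
    using t powr_mult[of 2 "2 * pi * t" "- q"] by simp
  hence "2 powr q * (2 * pi * (2 * t)) powr - q = (2 * pi * t) powr - q"
    by (simp add: powr_minus)
  hence "(2 * pi * t) powr (- real CARD('d) / 2)
      = 2 powr (real CARD('d) / 2) * (2 * pi * (2 * t)) powr (- real CARD('d) / 2)"
    by (simp add: q_def)
  moreover have "exp ((norm z)\<^sup>2 / (4 * t)) * exp (- (norm z)\<^sup>2 / (2 * t))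
      = exp (- (norm z)\<^sup>2 / (2 * (2 * t)))"
    using t by (simp add: field_simps flip: exp_add)
  ultimately show ?thesis by (simp add: gauss_density_def mult_ac)
qed

text \<open>If \<open>x\<close> is far out, then the data point \<open>y\<close> or the noise
  \<open>x - y\<close> is large, and the product of their exponential weights is at least
  \<open>n\<close>. This yields the factor \<open>1 / n\<close>, paid for by the exponential moment
  of \<open>y\<close> and by doubling the variance of the kernel.\<close>

lemma gauss_density_tail_weight:
  fixes x y :: "real ^ 'd" and t K :: real and n :: nat
  assumes t: "0 < t" and K: "0 < K" and n: "2 \<le> n"
    and x: "16 * (K + t) * ln n \<le> (norm x)\<^sup>2"
  shows "(4 * ln n / t + 2 * ((norm (x - y))\<^sup>2 / t\<^sup>2)) * gauss_density t (x - y)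
    \<le> (4 * ln n + 16) / (n * t) * 2 powr (real CARD('d) / 2) * exp ((norm y)\<^sup>2 / K)
        * gauss_density (2 * t) (x - y)"
proof -
  define L where "L = ln (real n)"
  have L: "0 \<le> L" using n by (simp add: L_def)
  define z where "z = x - y"
  \<comment> \<open>\<open>E\<close> is used twice: once to absorb the polynomial prefactor and once
    to gain \<open>1 / n\<close>. Its square is the weight handled by
    \<open>gauss_density_double\<close>.\<close>
  define E where "E = exp ((norm z)\<^sup>2 / (8 * t))"
  have E1: "1 \<le> E" using t by (simp add: E_def)
  have "(norm z)\<^sup>2 / (8 * t) \<le> E"
    using exp_ge_add_one_self[of "(norm z)\<^sup>2 / (8 * t)"] unfolding E_def by linarith
  hence E2: "(norm z)\<^sup>2 / t \<le> 8 * E" using t by (simp add: field_simps)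
  have "4 * L / t + 2 * ((norm z)\<^sup>2 / t\<^sup>2) = (4 * L + 2 * ((norm z)\<^sup>2 / t)) / t"
    using t by (simp add: field_simps power2_eq_square)
  also have "\<dots> \<le> (4 * L * E + 2 * (8 * E)) / t"
    using t E2 mult_left_mono[OF E1, of "4 * L"] L by (intro divide_right_mono add_mono) auto
  also have "\<dots> = (4 * L + 16) / t * E" by (simp add: algebra_simps add_divide_distrib)
  finally have 1: "4 * L / t + 2 * ((norm z)\<^sup>2 / t\<^sup>2) \<le> (4 * L + 16) / t * E" .
  have "(norm x)\<^sup>2 \<le> (norm y + norm z)\<^sup>2"
    using norm_triangle_ineq[of y z] by (intro power_mono) (auto simp: z_def)
  also have "\<dots> \<le> 2 * (norm y)\<^sup>2 + 2 * (norm z)\<^sup>2"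
    using zero_le_power2[of "norm y - norm z"] by (simp add: power2_eq_square algebra_simps)
  finally have "16 * (K + t) * L \<le> 2 * (norm y)\<^sup>2 + 2 * (norm z)\<^sup>2" using x by (simp add: L_def)
  \<comment> \<open>The 16 in the radius, divided by the 2 lost in squaring the triangle inequality,
    gives the 8 in the exponent of \<open>E\<close>.\<close>
  hence "L \<le> (2 * (norm y)\<^sup>2 + 2 * (norm z)\<^sup>2) / (16 * (K + t))"
    using K t by (simp add: pos_le_divide_eq mult.commute)
  also have "\<dots> = (norm y)\<^sup>2 / (8 * (K + t)) + (norm z)\<^sup>2 / (8 * (K + t))"
  proof -
    have "(2 * a + 2 * b) / (16 * c) = a / (8 * c) + b / (8 * c)" for a b c :: real
      by (simp add: add_divide_distrib)
    thus ?thesis .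
  qed
  also have "\<dots> \<le> (norm y)\<^sup>2 / K + (norm z)\<^sup>2 / (8 * t)"
    using K t by (intro add_mono divide_left_mono) auto
  finally have "exp L \<le> exp ((norm y)\<^sup>2 / K + (norm z)\<^sup>2 / (8 * t))" by simp
  hence "n \<le> exp ((norm y)\<^sup>2 / K) * E" using n by (simp add: L_def E_def exp_add)
  hence 2: "1 \<le> exp ((norm y)\<^sup>2 / K) * E / n" using n by simp
  have "(4 * L / t + 2 * ((norm z)\<^sup>2 / t\<^sup>2)) * gauss_density t z
      \<le> ((4 * L + 16) / t * E) * gauss_density t z"
    using 1 by (intro mult_right_mono) auto
  also have "\<dots> = ((4 * L + 16) / t * E * gauss_density t z) * 1" by simp
  also have "\<dots> \<le> ((4 * L + 16) / t * E * gauss_density t z) * (exp ((norm y)\<^sup>2 / K) * E / n)"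
    using t L E1 by (intro mult_left_mono 2) auto
  also have "\<dots> = (4 * L + 16) / (n * t) * exp ((norm y)\<^sup>2 / K) * ((E * E) * gauss_density t z)"
    by (simp add: mult_ac)
  also have "E * E = exp ((norm z)\<^sup>2 / (4 * t))"
    by (simp add: E_def flip: exp_add)
  also have "exp ((norm z)\<^sup>2 / (4 * t)) * gauss_density t z
      = 2 powr (real CARD('d) / 2) * gauss_density (2 * t) z"
    by (rule gauss_density_double[OF t])
  finally show ?thesis by (simp add: L_def z_def mult_ac)
qed

context borel_prob
begin

text \<open>By Tonelli the integral over \<open>x\<close> is taken first; the kernel of variance
  \<open>2 * t\<close> then contributes 1, and only the exponential moment of the data is
  left.\<close>

lemma tail_integral_bound:
  fixes t K B :: real and n :: nat
  assumes t: "0 < t" and K: "0 < K" and n: "2 \<le> n"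
    and B: "(\<integral>\<^sup>+ y. ennreal (exp ((norm y)\<^sup>2 / K)) \<partial>N) \<le> ennreal B" "0 \<le> B"
    and A: "\<And>x. x \<in> A \<Longrightarrow> 16 * (K + t) * ln n \<le> (norm x)\<^sup>2"
  shows "(\<integral>\<^sup>+ x. (\<integral>\<^sup>+ y. ennreal ((4 * ln n / t + 2 * ((norm (x - y))\<^sup>2 / t\<^sup>2))
           * gauss_density t (x - y)) \<partial>N) * indicator A x \<partial>lborel)
    \<le> ennreal ((4 * ln n + 16) / (n * t) * 2 powr (real CARD('d) / 2) * B)"
proof -
  define c where "c = (4 * ln n + 16) / (n * t) * 2 powr (real CARD('d) / 2)"
  have c: "0 \<le> c" using n t by (simp add: c_def)
  interpret P: pair_sigma_finite N lborel by standard
  have "(\<integral>\<^sup>+ x. (\<integral>\<^sup>+ y. ennreal ((4 * ln n / t + 2 * ((norm (x - y))\<^sup>2 / t\<^sup>2))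
           * gauss_density t (x - y)) \<partial>N) * indicator A x \<partial>lborel)
    \<le> (\<integral>\<^sup>+ x. (\<integral>\<^sup>+ y. ennreal (c * exp ((norm y)\<^sup>2 / K)) * ennreal (gauss_density (2 * t) (x - y)) \<partial>N)
         \<partial>lborel)"
  proof (rule nn_integral_mono)
    fix x :: "real ^ 'd"
    have "(\<integral>\<^sup>+ y. ennreal ((4 * ln n / t + 2 * ((norm (x - y))\<^sup>2 / t\<^sup>2)) * gauss_density t (x - y)) \<partial>N)
      \<le> (\<integral>\<^sup>+ y. ennreal (c * exp ((norm y)\<^sup>2 / K)) * ennreal (gauss_density (2 * t) (x - y)) \<partial>N)"
      if "x \<in> A"
    proof (rule nn_integral_mono)
      fix y
      show "ennreal ((4 * ln n / t + 2 * ((norm (x - y))\<^sup>2 / t\<^sup>2)) * gauss_density t (x - y))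
        \<le> ennreal (c * exp ((norm y)\<^sup>2 / K)) * ennreal (gauss_density (2 * t) (x - y))"
        using ennreal_leI[OF gauss_density_tail_weight[OF t K n A[OF that], of y]] c
        unfolding c_def[symmetric] by (subst ennreal_mult'[symmetric]) auto
    qed
    thus "(\<integral>\<^sup>+ y. ennreal ((4 * ln n / t + 2 * ((norm (x - y))\<^sup>2 / t\<^sup>2))
           * gauss_density t (x - y)) \<partial>N) * indicator A x
        \<le> (\<integral>\<^sup>+ y. ennreal (c * exp ((norm y)\<^sup>2 / K)) * ennreal (gauss_density (2 * t) (x - y)) \<partial>N)"
      by (auto simp: indicator_def)
  qed
  also have "\<dots> = (\<integral>\<^sup>+ y. (\<integral>\<^sup>+ x. ennreal (c * exp ((norm y)\<^sup>2 / K))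
      * ennreal (gauss_density (2 * t) (x - y)) \<partial>lborel) \<partial>N)"
    by (rule P.Fubini') measurable
  also have "\<dots> = (\<integral>\<^sup>+ y. ennreal (c * exp ((norm y)\<^sup>2 / K)) \<partial>N)"
    using t by (simp add: nn_integral_cmult nn_integral_gauss_density_shift)
  also have "\<dots> = ennreal c * (\<integral>\<^sup>+ y. ennreal (exp ((norm y)\<^sup>2 / K)) \<partial>N)"
    using c by (simp add: ennreal_mult nn_integral_cmult)
  also have "\<dots> \<le> ennreal c * ennreal B" by (intro mult_left_mono B) auto
  finally show ?thesis unfolding c_def[symmetric] using c B by (simp add: ennreal_mult)
qed

end

section \<open>The risk bound\<close>

context borel_prob
begin

text \<open>At a fixed point every \<open>1 / p\<close> in the deterministic bound meets a mean
  squared error proportional to \<open>p\<close>. The result is therefore uniform in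
  \<open>x\<close>, but not integrable over the whole space.\<close>

lemma kde_score_error_bulk:
  fixes n :: nat and t :: real
  assumes t: "0 < t" and n: "2 \<le> n"
  shows "(\<integral>\<^sup>+ xs. ennreal ((norm (kde_score n t xs x - mollify_grad N t x /\<^sub>R mollify N t x))\<^sup>2
           * mollify N t x) \<partial>Pi\<^sub>M {..<n} (\<lambda>_. N))
    \<le> ennreal ((16 * ln n + 4) * gauss_density t (0 :: real ^ 'd) / (n * t))"
proof -
  define M where "M = gauss_density t (0 :: real ^ 'd)"
  define p where "p = mollify N t x"
  define g where "g = mollify_grad N t x"
  define L where "L = ln (real n)"
  have L: "0 \<le> L" using n by (simp add: L_def)
  have p: "0 < p" using mollify_pos[OF t] by (simp add: p_def)
  have M: "0 < M" using t by (simp add: M_def)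
  have n0: "0 < n" using n by simp
  interpret P: prob_space "Pi\<^sub>M {..<n} (\<lambda>_. N)" by (intro prob_space_PiM prob_space_axioms)
  have [measurable]: "(\<lambda>xs. mollify (empirical n xs) t x) \<in> borel_measurable (Pi\<^sub>M {..<n} (\<lambda>_. N))"
    "(\<lambda>xs. mollify_grad (empirical n xs) t x) \<in> borel_measurable (Pi\<^sub>M {..<n} (\<lambda>_. N))"
    using n0 by (simp_all add: mollify_empirical mollify_grad_empirical)
  have "(\<integral>\<^sup>+ xs. ennreal ((norm (kde_score n t xs x - g /\<^sub>R p))\<^sup>2 * p) \<partial>Pi\<^sub>M {..<n} (\<lambda>_. N))
      \<le> (\<integral>\<^sup>+ xs. ennreal (2 / p) * ennreal ((norm (mollify_grad (empirical n xs) t x - g))\<^sup>2)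
          + ennreal (12 * L / (t * p)) * ennreal ((mollify (empirical n xs) t x - p)\<^sup>2)
          + ennreal ((4 * L + 2) * M / (n * t)) \<partial>Pi\<^sub>M {..<n} (\<lambda>_. N))"
  proof (rule nn_integral_mono)
    fix xs :: "nat \<Rightarrow> real ^ 'd"
    interpret E: borel_prob "empirical n xs" by (rule borel_prob_empirical)
    have "(norm (kde_score n t xs x - g /\<^sub>R p))\<^sup>2 * p
        \<le> 2 / p * (norm (mollify_grad (empirical n xs) t x - g))\<^sup>2
          + 12 * L / (t * p) * (mollify (empirical n xs) t x - p)\<^sup>2 + (4 * L + 2) * M / (n * t)"
      unfolding kde_score_def M_def[symmetric] L_def
      by (rule plugin_score_error_bulk[OF n t p])
        (use mollify_grad_log_bound[OF t] E.mollify_grad_log_bound[OF t] E.mollify_pos[OF t]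
          E.mollify_le[OF t] in \<open>auto simp: p_def g_def M_def\<close>)
    thus "ennreal ((norm (kde_score n t xs x - g /\<^sub>R p))\<^sup>2 * p)
        \<le> ennreal (2 / p) * ennreal ((norm (mollify_grad (empirical n xs) t x - g))\<^sup>2)
          + ennreal (12 * L / (t * p)) * ennreal ((mollify (empirical n xs) t x - p)\<^sup>2)
          + ennreal ((4 * L + 2) * M / (n * t))"
      using p t L M by (simp add: ennreal_leI flip: ennreal_mult ennreal_plus)
  qed
  also have "\<dots> = ennreal (2 / p)
        * (\<integral>\<^sup>+ xs. ennreal ((norm (mollify_grad (empirical n xs) t x - g))\<^sup>2) \<partial>Pi\<^sub>M {..<n} (\<lambda>_. N))
      + ennreal (12 * L / (t * p))
        * (\<integral>\<^sup>+ xs. ennreal ((mollify (empirical n xs) t x - p)\<^sup>2) \<partial>Pi\<^sub>M {..<n} (\<lambda>_. N))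
      + ennreal ((4 * L + 2) * M / (n * t))"
    by (simp add: nn_integral_add nn_integral_cmult P.emeasure_space_1)
  also have "\<dots> \<le> ennreal (2 / p) * ennreal (M / t * p / n)
      + ennreal (12 * L / (t * p)) * ennreal (M * p / n) + ennreal ((4 * L + 2) * M / (n * t))"
    unfolding M_def p_def g_def
    by (intro add_mono mult_left_mono mollify_mse[OF t n0] mollify_grad_mse[OF t n0]) auto
  also have "\<dots> = ennreal (2 / p * (M / t * p / n) + 12 * L / (t * p) * (M * p / n)
      + (4 * L + 2) * M / (n * t))"
    using p t L M by (simp flip: ennreal_mult ennreal_plus)
  \<comment> \<open>The terms contribute 2 from the gradient, \<open>12 * L\<close> from the density
    and \<open>4 * L + 2\<close> from the cut-off.\<close>
  also have "2 / p * (M / t * p / n) + 12 * L / (t * p) * (M * p / n) + (4 * L + 2) * M / (n * t)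
      = (16 * L + 4) * M / (n * t)"
    using p t n0 by (simp add: field_simps)
  finally show ?thesis by (simp add: p_def g_def M_def L_def)
qed

text \<open>The error is bounded for every sample, so the expectation costs nothing. The bound is
  written as one integral over \<open>N\<close> so that \<open>tail_integral_bound\<close> can
  exchange the integrals.\<close>

lemma kde_score_error_tail:
  fixes n :: nat and t :: real
  assumes t: "0 < t" and n: "2 \<le> n"
  shows "(\<integral>\<^sup>+ xs. ennreal ((norm (kde_score n t xs x - mollify_grad N t x /\<^sub>R mollify N t x))\<^sup>2
           * mollify N t x) \<partial>Pi\<^sub>M {..<n} (\<lambda>_. N))
    \<le> (\<integral>\<^sup>+ y. ennreal ((4 * ln n / t + 2 * ((norm (x - y))\<^sup>2 / t\<^sup>2)) * gauss_density t (x - y)) \<partial>N)"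
proof -
  define p where "p = mollify N t x"
  define g where "g = mollify_grad N t x"
  define S where "S = (\<integral>y. (norm (x - y))\<^sup>2 / t\<^sup>2 * gauss_density t (x - y) \<partial>N)"
  have p: "0 < p" using mollify_pos[OF t] by (simp add: p_def)
  interpret P: prob_space "Pi\<^sub>M {..<n} (\<lambda>_. N)" by (intro prob_space_PiM prob_space_axioms)
  have int: "integrable N (\<lambda>y. (norm (x - y))\<^sup>2 / t\<^sup>2 * gauss_density t (x - y))"
    using integrable_divide[OF integrable_norm_sq_gauss_density[OF t, of x], of "t\<^sup>2"] by simp
  have "(\<integral>\<^sup>+ xs. ennreal ((norm (kde_score n t xs x - g /\<^sub>R p))\<^sup>2 * p) \<partial>Pi\<^sub>M {..<n} (\<lambda>_. N))
      \<le> (\<integral>\<^sup>+ xs. ennreal (4 * ln n / t * p + 2 * S) \<partial>Pi\<^sub>M {..<n} (\<lambda>_. N))"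
  proof (intro nn_integral_mono ennreal_leI)
    fix xs :: "nat \<Rightarrow> real ^ 'd"
    interpret E: borel_prob "empirical n xs" by (rule borel_prob_empirical)
    have "(norm (kde_score n t xs x - g /\<^sub>R p))\<^sup>2 * p \<le> 4 * ln n / t * p + 2 * ((norm g)\<^sup>2 / p)"
      unfolding kde_score_def
      by (rule plugin_score_error_tail[OF n t p])
        (use mollify_grad_log_bound[OF t] E.mollify_grad_log_bound[OF t] E.mollify_pos[OF t]
          E.mollify_le[OF t] in \<open>auto simp: p_def g_def\<close>)
    also have "(norm g)\<^sup>2 / p \<le> S"
      using mollify_grad_sq_le[OF t, of x] p
      unfolding p_def[symmetric] g_def[symmetric] S_def[symmetric] by (simp add: pos_divide_le_eq mult.commute)
    finally show "(norm (kde_score n t xs x - g /\<^sub>R p))\<^sup>2 * p \<le> 4 * ln n / t * p + 2 * S" by simp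
  qed
  also have "\<dots> = ennreal (4 * ln n / t * p + 2 * S)" by (simp add: P.emeasure_space_1)
  also have "4 * ln n / t * p + 2 * S = (\<integral>y. 4 * ln n / t * gauss_density t (x - y)
      + 2 * ((norm (x - y))\<^sup>2 / t\<^sup>2 * gauss_density t (x - y)) \<partial>N)"
    unfolding p_def S_def mollify_def
    by (subst Bochner_Integration.integral_add)
      (use t int in \<open>auto simp del: times_divide_eq_left\<close>)
  also have "ennreal \<dots> = (\<integral>\<^sup>+ y. ennreal (4 * ln n / t * gauss_density t (x - y)
      + 2 * ((norm (x - y))\<^sup>2 / t\<^sup>2 * gauss_density t (x - y))) \<partial>N)"
    using t int n by (intro nn_integral_eq_integral[symmetric]) (auto simp del: times_divide_eq_left)
  finally show ?thesis by (simp add: p_def g_def algebra_simps)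
qed

lemma kde_score_risk:
  fixes n :: nat and t K B :: real
  assumes t: "0 < t" and n: "2 \<le> n" and K: "0 < K"
    and B: "(\<integral>\<^sup>+ y. ennreal (exp ((norm y)\<^sup>2 / K)) \<partial>N) \<le> ennreal B" "0 \<le> B"
  shows "(\<integral>\<^sup>+ xs. (\<integral>\<^sup>+ x. ennreal ((norm (kde_score n t xs x - mollify_grad N t x /\<^sub>R mollify N t x))\<^sup>2
           * mollify N t x) \<partial>lborel) \<partial>Pi\<^sub>M {..<n} (\<lambda>_. N))
    \<le> ennreal ((16 * ln n + 4) * gauss_density t (0 :: real ^ 'd) / (n * t)
          * (unit_ball_vol CARD('d) * sqrt (16 * (K + t) * ln n) ^ CARD('d))
        + (4 * ln n + 16) / (n * t) * 2 powr (real CARD('d) / 2) * B)"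
proof -
  \<comment> \<open>Beyond this radius \<open>gauss_density_tail_weight\<close> gains the factor
    \<open>1 / n\<close>.\<close>
  define R where "R = sqrt (16 * (K + t) * ln n)"
  define c where "c = (16 * ln n + 4) * gauss_density t (0 :: real ^ 'd) / (n * t)"
  define D where "D xs x = ennreal ((norm (kde_score n t xs x - mollify_grad N t x /\<^sub>R mollify N t x))\<^sup>2
           * mollify N t x)" for xs x
  define T where "T x = (\<integral>\<^sup>+ y. ennreal ((4 * ln n / t + 2 * ((norm (x - y))\<^sup>2 / t\<^sup>2))
      * gauss_density t (x - y)) \<partial>N)" for x
  have R: "0 \<le> R" using n t K by (simp add: R_def)
  have c: "0 \<le> c" using n t by (simp add: c_def)
  have n0 [simp]: "0 < n" using n by simp
  interpret P: prob_space "Pi\<^sub>M {..<n} (\<lambda>_. N)" by (intro prob_space_PiM prob_space_axioms)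
  interpret Q: pair_sigma_finite "Pi\<^sub>M {..<n} (\<lambda>_. N)" lborel by standard
  have [measurable_cong]: "sets (Pi\<^sub>M {..<n} (\<lambda>_. N)) = sets (Pi\<^sub>M {..<n} (\<lambda>_. borel))"
    by (intro sets_PiM_cong) auto
  have [measurable]: "(\<lambda>z. D (fst z) (snd z)) \<in> borel_measurable (Pi\<^sub>M {..<n} (\<lambda>_. N) \<Otimes>\<^sub>M lborel)"
    unfolding D_def by measurable
  have [measurable]: "T \<in> borel_measurable borel" unfolding T_def by measurable
  have [measurable]: "cball (0 :: real ^ 'd) R \<in> sets borel" by simp
  hence [measurable]: "- cball (0 :: real ^ 'd) R \<in> sets borel" by measurable
  \<comment> \<open>Tonelli moves the expectation inside, where the two error bounds for a fixed
    \<open>x\<close> apply: the uniform one on the ball and the integrable one outside.\<close>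
  have "(\<integral>\<^sup>+ xs. (\<integral>\<^sup>+ x. D xs x \<partial>lborel) \<partial>Pi\<^sub>M {..<n} (\<lambda>_. N))
      = (\<integral>\<^sup>+ x. (\<integral>\<^sup>+ xs. D xs x \<partial>Pi\<^sub>M {..<n} (\<lambda>_. N)) \<partial>lborel)"
    by (rule Q.Fubini'[symmetric]) (simp add: split_beta')
  also have "\<dots> \<le> (\<integral>\<^sup>+ x. ennreal c * indicator (cball 0 R) x + T x * indicator (- cball 0 R) x \<partial>lborel)"
  proof (rule nn_integral_mono)
    fix x :: "real ^ 'd"
    show "(\<integral>\<^sup>+ xs. D xs x \<partial>Pi\<^sub>M {..<n} (\<lambda>_. N))
        \<le> ennreal c * indicator (cball 0 R) x + T x * indicator (- cball 0 R) x"
      using kde_score_error_bulk[OF t n, of x] kde_score_error_tail[OF t n, of x]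
      unfolding D_def T_def c_def by (cases "x \<in> cball 0 R") auto
  qed
  also have "\<dots> = ennreal c * emeasure lborel (cball (0 :: real ^ 'd) R)
      + (\<integral>\<^sup>+ x. T x * indicator (- cball 0 R) x \<partial>lborel)"
    by (subst nn_integral_add) (auto simp: nn_integral_cmult_indicator)
  also have "(\<integral>\<^sup>+ x. T x * indicator (- cball 0 R) x \<partial>lborel)
      \<le> ennreal ((4 * ln n + 16) / (n * t) * 2 powr (real CARD('d) / 2) * B)"
    unfolding T_def
  proof (rule tail_integral_bound[OF t K n B])
    fix x :: "real ^ 'd" assume "x \<in> - cball 0 R"
    hence "R\<^sup>2 \<le> (norm x)\<^sup>2" using R by (intro power_mono) (auto simp: dist_norm)
    thus "16 * (K + t) * ln n \<le> (norm x)\<^sup>2" using K t n by (simp add: R_def)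
  qed
  also have "ennreal c * emeasure lborel (cball (0 :: real ^ 'd) R)
      = ennreal (c * (unit_ball_vol CARD('d) * R ^ CARD('d)))"
    using c R by (simp add: emeasure_cball ennreal_mult)
  finally have "(\<integral>\<^sup>+ xs. (\<integral>\<^sup>+ x. D xs x \<partial>lborel) \<partial>Pi\<^sub>M {..<n} (\<lambda>_. N))
      \<le> ennreal (c * (unit_ball_vol CARD('d) * R ^ CARD('d)))
        + ennreal ((4 * ln n + 16) / (n * t) * 2 powr (real CARD('d) / 2) * B)"
    by (simp add: add_mono)
  also have "\<dots> = ennreal (c * (unit_ball_vol CARD('d) * R ^ CARD('d))
      + (4 * ln n + 16) / (n * t) * 2 powr (real CARD('d) / 2) * B)"
    using c R n t B by (intro ennreal_plus[symmetric]) auto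
  finally show ?thesis by (simp add: D_def c_def R_def)
qed

end

section \<open>Reduction to the stated rate\<close>

lemma powr_add_le:
  fixes a b q :: real
  assumes "0 \<le> a" "0 \<le> b" "0 \<le> q"
  shows "(a + b) powr q \<le> 2 powr q * (a powr q + b powr q)"
proof -
  have "(a + b) powr q \<le> (2 * max a b) powr q" using assms by (intro powr_mono2) auto
  also have "\<dots> = 2 powr q * max a b powr q" using assms by (simp add: powr_mult)
  also have "\<dots> \<le> 2 powr q * (a powr q + b powr q)"
    by (intro mult_left_mono) (auto simp: max_def)
  finally show ?thesis .
qed

lemma gauss_density_0_le: "0 < t \<Longrightarrow> gauss_density t (0 :: real ^ 'd) \<le> t powr (- real CARD('d) / 2)"
proof -
  assume t: "0 < t"
  have "1 * t \<le> 2 * pi * t" using t pi_gt3 by (intro mult_right_mono) auto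
  hence "(2 * pi * t) powr (- (real CARD('d) / 2)) \<le> t powr (- (real CARD('d) / 2))"
    using t by (intro powr_mono2') auto
  thus ?thesis by (simp add: gauss_density_def)
qed

text \<open>The ball has volume of order \<open>(K + t) powr (d / 2)\<close> up to logarithms, and
  the peak value supplies \<open>t powr (- d / 2)\<close>. The tail term reaches the same shape by
  inserting \<open>t powr (- d / 2) * t powr (d / 2) = 1\<close>.\<close>

lemma risk_rate:
  fixes K \<sigma> V t G :: real and n d :: nat
  assumes K: "0 < K" and \<sigma>: "0 < \<sigma>" and V: "0 \<le> V" and t: "0 < t" and n: "2 \<le> n"
    and G: "G \<le> t powr (- real d / 2)" "0 \<le> G"
  shows "(16 * ln n + 4) * G / (n * t) * (V * sqrt (16 * (K + t) * ln n) ^ d)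
        + (4 * ln n + 16) / (n * t) * 2 powr (real d / 2) * (2 * real d)
    \<le> (24 * V * 32 powr (real d / 2) * (1 + K powr (real d / 2) / \<sigma> ^ d) + 72 * (real d + 1) * 2 ^ d)
        * ln n powr (1 + real d / 2) * (1 / n) * t powr (- (real d + 2) / 2)
        * (t powr (real d / 2) + \<sigma> ^ d)"
proof -
  define q where "q = real d / 2"
  define L where "L = ln (real n)"
  \<comment> \<open>\<open>K\<close> need not be comparable to the square of \<sigma> with a
    universal constant; the ratio is put into the hidden constant, which may depend on the
    density.\<close>
  define \<kappa> where "\<kappa> = 1 + K powr q / \<sigma> ^ d"
  have q: "0 \<le> q" by (simp add: q_def)
  \<comment> \<open>The lower bound 1/2 for \<open>L\<close> absorbs the additive constants:
    \<open>16 * L + 4\<close> is at most \<open>24 * L\<close>, and \<open>4 * L + 16\<close> at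
    most \<open>36 * L\<close>.\<close>
  have "ln 2 \<le> L" using n by (simp add: L_def)
  moreover have "1 / 2 \<le> ln (2 :: real)"
    using ln_add_one_self_le_self2[of "-1/2"] by (simp add: ln_div)
  ultimately have L: "1 / 2 \<le> L" by simp
  have \<kappa>: "1 \<le> \<kappa>" using \<sigma> by (simp add: \<kappa>_def)
  have tt: "t powr (- (real d + 2) / 2) = t powr (- q) / t"
  proof -
    have "- (real d + 2) / 2 = - q + - 1" by (simp add: q_def field_simps)
    thus ?thesis using t by (simp only: powr_add powr_neg_one) simp
  qed
  have R: "sqrt (16 * (K + t) * L) ^ d \<le> 32 powr q * L powr q * \<kappa> * (t powr q + \<sigma> ^ d)"
  proof -
    have "sqrt (16 * (K + t) * L) ^ d = (16 * (K + t) * L) powr q"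
    proof -
      have "sqrt w ^ d = w powr q" if "0 < w" for w
      proof -
        have "sqrt w ^ d = sqrt w powr real d" using that by (intro powr_realpow[symmetric]) simp
        also have "\<dots> = (w powr (1 / 2)) powr real d" using that by (simp add: powr_half_sqrt)
        finally show ?thesis by (simp add: powr_powr q_def)
      qed
      thus ?thesis using K t L by simp
    qed
    also have "\<dots> = 16 powr q * L powr q * (K + t) powr q"
      using K t L by (simp add: powr_mult del: distrib_left_numeral)
    also have "\<dots> \<le> 16 powr q * L powr q * (2 powr q * (K powr q + t powr q))"
      using K t q by (intro mult_left_mono powr_add_le) auto
    also have "\<dots> = 32 powr q * L powr q * (K powr q + t powr q)"
      using powr_mult[of 16 2 q] by simp
    also have "K powr q + t powr q \<le> \<kappa> * (t powr q + \<sigma> ^ d)"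
    proof -
      have "K powr q = K powr q / \<sigma> ^ d * \<sigma> ^ d" using \<sigma> by simp
      also have "\<dots> \<le> \<kappa> * \<sigma> ^ d" using \<sigma> by (intro mult_right_mono) (auto simp: \<kappa>_def)
      finally show ?thesis
        using mult_right_mono[OF \<kappa>, of "t powr q"] by (simp add: distrib_left)
    qed
    finally show ?thesis by (simp add: mult_left_mono mult.assoc)
  qed
  have "(16 * L + 4) * G / (n * t) * (V * sqrt (16 * (K + t) * L) ^ d)
      \<le> (24 * L) * t powr (- q) / (n * t) * (V * (32 powr q * L powr q * \<kappa> * (t powr q + \<sigma> ^ d)))"
    using L G t V R K \<sigma> by (intro mult_mono divide_right_mono) (auto simp: q_def)
  also have "\<dots> = 24 * V * 32 powr q * \<kappa> * L powr (1 + q) * (1 / n) * (t powr (- q) / t) * (t powr q + \<sigma> ^ d)"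
    using L t by (simp add: powr_add)
  finally have 1: "(16 * L + 4) * G / (n * t) * (V * sqrt (16 * (K + t) * L) ^ d)
      \<le> 24 * V * 32 powr q * \<kappa> * L powr (1 + q) * (1 / n) * (t powr (- q) / t) * (t powr q + \<sigma> ^ d)" .
  \<comment> \<open>The tail term has only one power of \<open>L\<close>; as \<open>2 * L\<close> is
    at least 1, it is raised to the power \<open>1 + q\<close> of the first term at the price of
    \<open>2 powr q\<close>.\<close>
  have "1 \<le> (2 * L) powr q" using L q by (intro ge_one_powr_ge_zero) auto
  hence "L * 1 \<le> L * (2 powr q * L powr q)" using L by (intro mult_left_mono) (auto simp: powr_mult)
  hence LL: "L \<le> 2 powr q * L powr (1 + q)" using L by (simp add: powr_add)
  have "(4 * L + 16) / (n * t) * 2 powr q * (2 * real d)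
      \<le> 36 * L / (n * t) * 2 powr q * (2 * (real d + 1))"
    using L t by (intro mult_mono divide_right_mono) auto
  also have "\<dots> \<le> 36 * (2 powr q * L powr (1 + q)) / (n * t) * 2 powr q * (2 * (real d + 1))"
    using LL t by (intro mult_right_mono divide_right_mono mult_left_mono) auto
  also have "\<dots> = 72 * (real d + 1) * (2 powr q * 2 powr q) * L powr (1 + q) * (1 / n)
      * (t powr (- q) / t) * t powr q"
    using t by (simp add: powr_minus)
  also have "2 powr q * 2 powr q = (2 :: real) ^ d"
    by (simp add: q_def powr_realpow flip: powr_add)
  also have "72 * (real d + 1) * 2 ^ d * L powr (1 + q) * (1 / n) * (t powr (- q) / t) * t powr q
      \<le> 72 * (real d + 1) * 2 ^ d * L powr (1 + q) * (1 / n) * (t powr (- q) / t) * (t powr q + \<sigma> ^ d)"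
    using t \<sigma> by (intro mult_left_mono) auto
  finally have 2: "(4 * L + 16) / (n * t) * 2 powr q * (2 * real d)
      \<le> 72 * (real d + 1) * 2 ^ d * L powr (1 + q) * (1 / n) * (t powr (- q) / t) * (t powr q + \<sigma> ^ d)" .
  show ?thesis
    using add_mono[OF 1 2] unfolding tt
    unfolding q_def[symmetric] L_def[symmetric] \<kappa>_def[symmetric] by (simp add: algebra_simps add_divide_distrib)
qed

theorem theorem3p5:
  "\<exists>(W :: (nat \<Rightarrow> real) measure) (shat :: 'd::finite score_rule).
     score_estimator W shat \<and>
     (\<forall>(p0 :: real ^ 'd \<Rightarrow> real) (\<sigma>0 :: real).
        probability_density p0 \<and> sub_gaussian (law p0) (\<lambda>x. x) \<sigma>0 \<longrightarrow>
        (\<forall>(T1 :: real) (T2 :: real). 0 < T1 \<and> 0 < T2 \<longrightarrow>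
           (\<exists>(A :: real) (C :: real). 0 < A \<and>
              (\<forall>(n :: nat) (t :: real).
                 2 \<le> n \<and> real n powr (- T1) < t \<and> t < real n powr T2 \<longrightarrow>
                 score_risk W shat p0 n t
                 \<le> ennreal (A * ln (real n) powr C * (1 / real n)
                     * t powr (- (real CARD('d) + 2) / 2)
                     * (t powr (real CARD('d) / 2) + \<sigma>0 ^ CARD('d)))))))"
proof -
  \<comment> \<open>The rule is deterministic, so the auxiliary law is a point mass at the zero
    sequence and integrates out.\<close>
  define W :: "(nat \<Rightarrow> real) measure" where "W = return (Pi\<^sub>M UNIV (\<lambda>_. borel)) (\<lambda>_. 0)"
  define shat :: "'d score_rule" where "shat n t xs u x = kde_score n t xs x" for n t xs u x
  have W: "prob_space W" unfolding W_def by (rule prob_space_return) (simp add: space_PiM)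
  interpret W: prob_space W by (rule W)
  have est: "score_estimator W shat"
    unfolding score_estimator_def
  proof (intro conjI allI impI W)
    show "sets W = sets (Pi\<^sub>M UNIV (\<lambda>_. borel))" by (simp add: W_def)
    fix n :: nat and t :: real assume "2 \<le> n"
    hence "0 < n" by simp
    have "(\<lambda>z. (fst z, snd (snd z)))
        \<in> (Pi\<^sub>M {..<n} (\<lambda>_. borel) \<Otimes>\<^sub>M W \<Otimes>\<^sub>M borel)
          \<rightarrow>\<^sub>M (Pi\<^sub>M {..<n} (\<lambda>_. borel) \<Otimes>\<^sub>M (borel :: (real ^ 'd) measure))"
      by measurable
    from measurable_compose[OF this measurable_pair_kde_score[OF \<open>0 < n\<close>]]
    have "(\<lambda>z. kde_score n t (fst z) (snd (snd z)) :: real ^ 'd)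
        \<in> borel_measurable (Pi\<^sub>M {..<n} (\<lambda>_. borel) \<Otimes>\<^sub>M W \<Otimes>\<^sub>M borel)"
      by simp
    thus "(\<lambda>(xs, u, x). shat n t xs u x)
        \<in> borel_measurable (Pi\<^sub>M {..<n} (\<lambda>_. borel) \<Otimes>\<^sub>M W \<Otimes>\<^sub>M borel)"
      by (simp add: shat_def split_beta')
  qed
  have rate: "\<exists>A C. 0 < A \<and> (\<forall>(n :: nat) (t :: real). 2 \<le> n \<and> 0 < t \<longrightarrow>
      score_risk W shat p n t
        \<le> ennreal (A * ln (real n) powr C * (1 / real n) * t powr (- (real CARD('d) + 2) / 2)
            * (t powr (real CARD('d) / 2) + \<sigma> ^ CARD('d))))"
    if p: "probability_density p" and sg: "sub_gaussian (law p) (\<lambda>x. x) \<sigma>"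
    for p :: "real ^ 'd \<Rightarrow> real" and \<sigma>
  proof -
    interpret borel_prob "law p" by (rule borel_prob_law[OF p])
    \<comment> \<open>Needed because the constant \<open>A\<close> contains a division by a power of
      \<sigma>.\<close>
    have \<sigma>: "0 < \<sigma>" by (rule sub_gaussian_density_pos[OF p sg])
    obtain K where K: "0 < K"
      "(\<integral>\<^sup>+ y. ennreal (exp ((norm y)\<^sup>2 / K)) \<partial>law p) \<le> ennreal (2 * real CARD('d))"
      using sub_gaussian_exp_moment[OF prob_space_axioms _ sg] by auto
    define A where "A = 24 * unit_ball_vol CARD('d) * 32 powr (real CARD('d) / 2)
        * (1 + K powr (real CARD('d) / 2) / \<sigma> ^ CARD('d)) + 72 * (real CARD('d) + 1) * 2 ^ CARD('d)"
    have A: "0 < A" using \<sigma> unfolding A_def by (intro add_nonneg_pos) auto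
    have "score_risk W shat p n t
        \<le> ennreal (A * ln (real n) powr (1 + real CARD('d) / 2) * (1 / real n)
            * t powr (- (real CARD('d) + 2) / 2) * (t powr (real CARD('d) / 2) + \<sigma> ^ CARD('d)))"
      if n: "2 \<le> n" and t: "0 < t" for n :: nat and t :: real
    proof -
      define D where "D xs x = ennreal ((norm (kde_score n t xs x
          - mollify_grad (law p) t x /\<^sub>R mollify (law p) t x))\<^sup>2 * mollify (law p) t x)" for xs x
      have [simp]: "0 < n" using n by simp
      have [measurable_cong]: "sets (Pi\<^sub>M {..<n} (\<lambda>_. law p)) = sets (Pi\<^sub>M {..<n} (\<lambda>_. borel))"
        by (intro sets_PiM_cong) auto
      have [measurable]: "(\<lambda>z. D (fst z) (snd z)) \<in> borel_measurable (Pi\<^sub>M {..<n} (\<lambda>_. law p) \<Otimes>\<^sub>M lborel)"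
        unfolding D_def by measurable
      have [measurable]: "(\<lambda>xs. \<integral>\<^sup>+ x. D xs x \<partial>lborel) \<in> borel_measurable (Pi\<^sub>M {..<n} (\<lambda>_. law p))"
        by (rule lborel.borel_measurable_nn_integral) (simp add: split_beta')
      have "score_risk W shat p n t
          = (\<integral>\<^sup>+ z. (\<integral>\<^sup>+ x. D (fst z) x \<partial>lborel) \<partial>(Pi\<^sub>M {..<n} (\<lambda>_. law p) \<Otimes>\<^sub>M W))"
        unfolding score_risk_def D_def shat_def score_eq[OF p t] smoothed_eq_mollify[OF p]
        by (simp add: split_beta')
      also have "\<dots> = (\<integral>\<^sup>+ xs. (\<integral>\<^sup>+ u. (\<integral>\<^sup>+ x. D xs x \<partial>lborel) \<partial>W) \<partial>Pi\<^sub>M {..<n} (\<lambda>_. law p))"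
        by (subst W.nn_integral_fst[symmetric]) auto
      also have "\<dots> = (\<integral>\<^sup>+ xs. (\<integral>\<^sup>+ x. D xs x \<partial>lborel) \<partial>Pi\<^sub>M {..<n} (\<lambda>_. law p))"
        by (simp add: W.emeasure_space_1)
      also have "\<dots> \<le> ennreal ((16 * ln n + 4) * gauss_density t (0 :: real ^ 'd) / (n * t)
            * (unit_ball_vol CARD('d) * sqrt (16 * (K + t) * ln n) ^ CARD('d))
          + (4 * ln n + 16) / (n * t) * 2 powr (real CARD('d) / 2) * (2 * real CARD('d)))"
        unfolding D_def using K by (intro kde_score_risk t n) auto
      also have "\<dots> \<le> ennreal (A * ln (real n) powr (1 + real CARD('d) / 2) * (1 / real n)
            * t powr (- (real CARD('d) + 2) / 2) * (t powr (real CARD('d) / 2) + \<sigma> ^ CARD('d)))"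
        unfolding A_def
        by (intro ennreal_leI risk_rate K \<sigma> t n gauss_density_0_le) auto
      finally show ?thesis .
    qed
    with A show ?thesis by blast
  qed
  have "\<exists>A C. 0 < A \<and> (\<forall>(n :: nat) (t :: real). 2 \<le> n \<and> real n powr (- T1) < t \<and> t < real n powr T2 \<longrightarrow>
      score_risk W shat p n t
        \<le> ennreal (A * ln (real n) powr C * (1 / real n) * t powr (- (real CARD('d) + 2) / 2)
            * (t powr (real CARD('d) / 2) + \<sigma> ^ CARD('d))))"
    if "probability_density p" "sub_gaussian (law p) (\<lambda>x. x) \<sigma>"
    for p :: "real ^ 'd \<Rightarrow> real" and \<sigma> T1 T2
    \<comment> \<open>Positivity of \<open>t\<close> follows from \<open>n powr (- T1) < t\<close>,
      as a power is nonnegative.\<close>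
    using rate[OF that] powr_ge_zero le_less_trans by metis
  with est show ?thesis by blast
qed

end
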